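(* Let $F$ be a binary quartic form with integer coefficients and non-zero discriminant, and let $F_6$ be its sextic covariant. Then: (1) $\operatorname{Aut} F = \{\pm I_{2\times 2}\}$ if and only if $F_6$ does not have any real rationally good significant quadratic factors. (2) $\operatorname{Aut} F$ is generated by $U_f \in \operatorname{GL}_2(\mathbb{Q})$ and $-I_{2\times 2}$ if and only if $F_6$ has a unique (up to scalar multiples) real rationally good significant factor $f$. In this case $\operatorname{Aut} F$ is isomorphic to $\mathcal{C}_2\times\mathcal{C}_2$ or $\mathcal{C}_4$. (3) $\operatorname{Aut} F = \{\pm I_{2\times 2}, \pm U_{f_1}, \pm U_{f_2}, \pm U_{f_3}\} \cong \mathcal{D}_4$ if and only if $F_6$ can be written as $F_6 = f_1f_2f_3$ where $f_i$ is a real rationally good significant factor of $F_6$ for $i=1,2,3$.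
   Context: For $T = \begin{pmatrix} t_1 & t_2 \\ t_3 & t_4\end{pmatrix}$ put $F_T(x,y) = F(t_1 x + t_2 y, t_3 x + t_4 y)$, and $\operatorname{Aut} F = \{T \in \operatorname{GL}_2(\mathbb{Q}) : F_T = F\}$. $\mathcal{C}_n$ is the cyclic group of order $n$ and $\mathcal{D}_n$ the dihedral group of order $2n$. For $F = a_4x^4+a_3x^3y+a_2x^2y^2+a_1xy^3+a_0y^4$, the sextic covariant is \begin{align*} F_6(x,y) &= (a_3^3+8a_4^2a_1-4a_4a_3a_2)x^6 + 2(16a_4^2a_0+2a_4a_3a_1-4a_4a_2^2+a_3^2a_2)x^5y \\ &\quad + 5(8a_4a_3a_0+a_3^2a_1-4a_4a_2a_1)x^4y^2 + 20(a_3^2a_0-a_4a_1^2)x^3y^3 \\ &\quad - 5(8a_4a_1a_0+a_3a_1^2-4a_3a_2a_0)x^2y^4 - 2(16a_4a_0^2+2a_3a_1a_0-4a_2^2a_0+a_2a_1^2)xy^5 \\ &\quad - (a_1^3+8a_3a_0^2-4a_2a_1a_0)y^6. \end{align*} For a binary quartic form $G = g_4x^4+g_3x^3y+g_2x^2y^2+g_1xy^3+g_0y^4$, put $J(G) = 72g_4g_2g_0+9g_3g_2g_1-27g_4g_1^2-27g_0g_3^2-2g_2^3$. A quadratic form divisor $f$ of $F_6$ is called significant if the quartic form $G=F_6/f$ satisfies $J(G)=0$. For a quadratic form $f = ax^2+bxy+cy^2$ put $\Delta(f)=b^2-4ac$. A binary quadratic form $f$ with complex coefficients is rationally good if it is proportional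 over $\mathbb{C}$ to a quadratic form $g$ with integer coefficients and $|\Delta(g)|$ the square of an integer. "Real" means having real coefficients. For $f$ real with $\Delta(f)\neq 0$, \[U_f = \frac{1}{\sqrt{|\Delta(f)|}}\begin{pmatrix} b & 2c\\ -2a & -b\end{pmatrix}.\] *)

theory Defs
  imports "HOL-Analysis.Analysis" "HOL-Algebra.Elementary_Groups"
begin

section \<open>Binary forms\<close>

text \<open>
  A form is given by its coefficients and evaluated by \<open>eval2\<close>, \<open>eval4\<close>. All identities between
  forms are stated as identities of the evaluation functions over the real or complex numbers;
  as these fields are infinite, this is the same as equality of the polynomials.
\<close>

datatype 'a quadratic = Quadratic 'a 'a 'a

datatype 'a quartic = Quartic 'a 'a 'a 'a 'a

fun eval2 :: "'a::comm_ring_1 quadratic \<Rightarrow> 'a \<Rightarrow> 'a \<Rightarrow> 'a" where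
  "eval2 (Quadratic a b c) x y = a * x^2 + b * x * y + c * y^2"

fun eval4 :: "'a::comm_ring_1 quartic \<Rightarrow> 'a \<Rightarrow> 'a \<Rightarrow> 'a" where
  "eval4 (Quartic a4 a3 a2 a1 a0) x y =
     a4 * x^4 + a3 * x^3 * y + a2 * x^2 * y^2 + a1 * x * y^3 + a0 * y^4"

fun Delta :: "'a::comm_ring_1 quadratic \<Rightarrow> 'a" where
  "Delta (Quadratic a b c) = b^2 - 4 * a * c"

fun disc4 :: "'a::comm_ring_1 quartic \<Rightarrow> 'a" where
  "disc4 (Quartic a b c d e) =
     256 * a^3 * e^3 - 192 * a^2 * b * d * e^2 - 128 * a^2 * c^2 * e^2
     + 144 * a^2 * c * d^2 * e - 27 * a^2 * d^4 + 144 * a * b^2 * c * e^2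
     - 6 * a * b^2 * d^2 * e - 80 * a * b * c^2 * d * e + 18 * a * b * c * d^3
     + 16 * a * c^4 * e - 4 * a * c^3 * d^2 - 27 * b^4 * e^2 + 18 * b^3 * c * d * e
     - 4 * b^3 * d^3 - 4 * b^2 * c^3 * e + b^2 * c^2 * d^2"

text \<open>
  This is the discriminant in the usual normalisation: it is the product of the squared
  determinants of all pairs of linear factors, for the form that is the product of the
  \<open>p\<^sub>i x + q\<^sub>i y\<close>.
\<close>

lemma disc4_mult_quadratic:
  fixes a b c d e f :: "'a::idom"
  shows "disc4 (Quartic (a * d) (a * e + b * d) (a * f + b * e + c * d) (b * f + c * e) (c * f)) =
    (b^2 - 4 * a * c) * (e^2 - 4 * d * f) *
    ((a * f - c * d)^2 - (a * e - b * d) * (b * f - c * e))^2"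
  unfolding disc4.simps by algebra

lemma disc4_eq_prod:
  fixes p1 q1 p2 q2 p3 q3 p4 q4 :: "'a::idom"
  shows "disc4 (Quartic
      (p1 * p2 * p3 * p4)
      (q1 * p2 * p3 * p4 + p1 * q2 * p3 * p4 + p1 * p2 * q3 * p4 + p1 * p2 * p3 * q4)
      (q1 * q2 * p3 * p4 + q1 * p2 * q3 * p4 + q1 * p2 * p3 * q4
        + p1 * q2 * q3 * p4 + p1 * q2 * p3 * q4 + p1 * p2 * q3 * q4)
      (p1 * q2 * q3 * q4 + q1 * p2 * q3 * q4 + q1 * q2 * p3 * q4 + q1 * q2 * q3 * p4)
      (q1 * q2 * q3 * q4))
    = ((p1 * q2 - p2 * q1) * (p1 * q3 - p3 * q1) * (p1 * q4 - p4 * q1)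
        * (p2 * q3 - p3 * q2) * (p2 * q4 - p4 * q2) * (p3 * q4 - p4 * q3))^2"
    (is "disc4 (Quartic ?a ?b ?c ?d ?e) = ?R")
proof -
  have *: "?a = (p1*p2)*(p3*p4)" "?b = (p1*p2)*(p3*q4+p4*q3)+(p1*q2+p2*q1)*(p3*p4)"
   "?c = (p1*p2)*(q3*q4)+(p1*q2+p2*q1)*(p3*q4+p4*q3)+(q1*q2)*(p3*p4)"
   "?d = (p1*q2+p2*q1)*(q3*q4)+(q1*q2)*(p3*q4+p4*q3)" "?e = (q1*q2)*(q3*q4)"
    by (simp_all add: algebra_simps)
  have D: "(p*w+r*u)^2 - 4*(p*r)*(u*w) = (p*w-r*u)^2" for p u r w :: 'a
    by (simp add: algebra_simps power2_eq_square)
  have R: "((p1*p2)*(q3*q4)-(q1*q2)*(p3*p4))^2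
      - ((p1*p2)*(p3*q4+p4*q3)-(p1*q2+p2*q1)*(p3*p4))
        * ((p1*q2+p2*q1)*(q3*q4)-(q1*q2)*(p3*q4+p4*q3))
    = (p1 * q3 - p3 * q1) * (p1 * q4 - p4 * q1) * (p2 * q3 - p3 * q2) * (p2 * q4 - p4 * q2)"
    by (simp add: algebra_simps power2_eq_square)
  show ?thesis
    unfolding * disc4_mult_quadratic D R by (simp add: power_mult_distrib mult_ac)
qed

fun J_inv :: "'a::comm_ring_1 quartic \<Rightarrow> 'a" where
  "J_inv (Quartic g4 g3 g2 g1 g0) =
     72 * g4 * g2 * g0 + 9 * g3 * g2 * g1 - 27 * g4 * g1^2 - 27 * g0 * g3^2 - 2 * g2^3"

fun sextic_covariant :: "'a::comm_ring_1 quartic \<Rightarrow> 'a \<Rightarrow> 'a \<Rightarrow> 'a" where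
  "sextic_covariant (Quartic a4 a3 a2 a1 a0) x y =
     (a3^3 + 8 * a4^2 * a1 - 4 * a4 * a3 * a2) * x^6
     + 2 * (16 * a4^2 * a0 + 2 * a4 * a3 * a1 - 4 * a4 * a2^2 + a3^2 * a2) * x^5 * y
     + 5 * (8 * a4 * a3 * a0 + a3^2 * a1 - 4 * a4 * a2 * a1) * x^4 * y^2
     + 20 * (a3^2 * a0 - a4 * a1^2) * x^3 * y^3
     - 5 * (8 * a4 * a1 * a0 + a3 * a1^2 - 4 * a3 * a2 * a0) * x^2 * y^4
     - 2 * (16 * a4 * a0^2 + 2 * a3 * a1 * a0 - 4 * a2^2 * a0 + a2 * a1^2) * x * y^5
     - (a1^3 + 8 * a3 * a0^2 - 4 * a2 * a1 * a0) * y^6"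

definition significant_factor :: "complex quartic \<Rightarrow> complex quadratic \<Rightarrow> bool" where
  "significant_factor F f \<longleftrightarrow>
     (\<exists>G. (\<forall>x y. sextic_covariant F x y = eval2 f x y * eval4 G x y) \<and> J_inv G = 0)"

definition proportional :: "'a::comm_ring_1 quadratic \<Rightarrow> 'a quadratic \<Rightarrow> bool" where
  "proportional f g \<longleftrightarrow> (\<exists>c. c \<noteq> 0 \<and> f = map_quadratic ((*) c) g)"

definition rationally_good :: "complex quadratic \<Rightarrow> bool" where
  "rationally_good f \<longleftrightarrow>
     (\<exists>g :: int quadratic. proportional f (map_quadratic of_int g) \<and> (\<exists>k. \<bar>Delta g\<bar> = k^2))"

definition real_good_factor :: "int quartic \<Rightarrow> real quadratic \<Rightarrow> bool" where
  "real_good_factor F f \<longleftrightarrow>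
     significant_factor (map_quartic of_int F) (map_quadratic complex_of_real f) \<and>
     rationally_good (map_quadratic complex_of_real f)"

section \<open>Automorphism groups\<close>

text \<open>
  \<open>GL\<^sub>2(\<rat>)\<close> is realised inside the real matrices (the inverse of an invertible matrix with
  rational entries has rational entries), so that it can contain the real matrices \<open>U_mat f\<close>.
\<close>

definition GL2Q :: "(real^2^2) monoid" where
  "GL2Q = \<lparr>carrier = {T. invertible T \<and> (\<forall>i j. T $ i $ j \<in> \<rat>)}, mult = (**), one = mat 1\<rparr>"

definition subst_form :: "('a::comm_ring_1 \<Rightarrow> 'a \<Rightarrow> 'a) \<Rightarrow> 'a^2^2 \<Rightarrow> 'a \<Rightarrow> 'a \<Rightarrow> 'a" where
  "subst_form F T x y = F (T $ 1 $ 1 * x + T $ 1 $ 2 * y) (T $ 2 $ 1 * x + T $ 2 $ 2 * y)"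

definition Aut :: "int quartic \<Rightarrow> (real^2^2) monoid" where
  "Aut F = GL2Q\<lparr>carrier := {T \<in> carrier GL2Q.
     subst_form (eval4 (map_quartic of_int F)) T = eval4 (map_quartic of_int F)}\<rparr>"

fun U_mat :: "real quadratic \<Rightarrow> real^2^2" where
  "U_mat (Quadratic a b c) = (1 / sqrt \<bar>Delta (Quadratic a b c)\<bar>) *\<^sub>R
     vector [vector [b, 2 * c], vector [- 2 * a, - b]]"

text \<open>
  The dihedral group of order \<open>2 n\<close>: the pair \<open>(i, s)\<close> stands for \<open>r\<^sup>i \<sigma>\<^sup>s\<close>, where
  \<open>\<sigma> r \<sigma> = r\<^sup>-\<^sup>1\<close>.
\<close>

definition dihedral_group :: "nat \<Rightarrow> (int \<times> bool) monoid" where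
  "dihedral_group n =
     \<lparr>carrier = carrier (integer_mod_group n) \<times> UNIV,
      mult = (\<lambda>(i, s) (j, t). ((if s then i - j else i + j) mod int n, s \<noteq> t)),
      one = (0, False)\<rparr>"

end

(* Over the complex numbers F is equivalent to H = x^4 + m x^2 y^2 + y^4 with m^2 <> 4, and
   F_6(H) = 8 (4 - m^2) x y (x^2 - y^2) (x^2 + y^2). The significant factors of H are, up to
   scalars, the three quadratics displayed, so all three are pairwise orthogonal for the polar
   form of Delta and each U_f preserves F. Conversely, an automorphism of determinant +-1 fixes
   H and its Hessian, hence x^2 y^2, which forces it to be scalar or proportional to the matrix
   of one of the three quadratics. The invariants I and J show that a real automorphism has
   determinant +-1, so Aut F consists of +-1 and the matrices +-U_f for the real rationally good
   significant f. The group with three such f is dihedral and not the quaternion group because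
   two orthogonal real quadratics cannot both be definite. *)

theory Submission
  imports Defs "HOL-Computational_Algebra.Fundamental_Theorem_Algebra"
begin

section \<open>Covariants and invariants under linear substitutions\<close>

text \<open>Up to scalars the sextic of the normal form has fifteen quadratic divisors, one for each
  pair of its six linear factors. \<open>J_inv\<close> of the cofactor is what singles out three of
  them; being an invariant, it can be tested on the normal form and the answer carried back to
  \<open>F\<close>. The dictionary between matrices and quadratic forms is the map that sends a
  matrix T to the form det(z, T z), where z = (x, y). On matrices of trace zero it inverts f
  \<mapsto> (b, 2c; -2a, -b) up to the factor -2, and it commutes with changes of variables up to
  their determinant. The normal form and the notion of significance live over the complex numbers,
  the automorphisms over the rationals. Complex scalars between real forms therefore have to be
  shown real, and \<open>rationally_good_iff\<close> translates the arithmetic condition on f into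
  rational entries of the normalised matrix.\<close>

fun subst2 :: "'a::idom quadratic \<Rightarrow> 'a \<Rightarrow> 'a \<Rightarrow> 'a \<Rightarrow> 'a \<Rightarrow> 'a quadratic" where
  "subst2 (Quadratic a b c) p q r s =
     Quadratic (a * p^2 + b * p * r + c * r^2)
       (2 * a * p * q + b * (p * s + q * r) + 2 * c * r * s)
       (a * q^2 + b * q * s + c * s^2)"

text \<open>Coefficients of F(px + qy, rx + sy), expanded so that covariance becomes a polynomial
  identity in the coefficients and the matrix entries.\<close>

fun subst4 :: "'a::idom quartic \<Rightarrow> 'a \<Rightarrow> 'a \<Rightarrow> 'a \<Rightarrow> 'a \<Rightarrow> 'a quartic" where
  "subst4 (Quartic a b c d e) p q r s =
     Quartic
       (a * p^4 + b * p^3 * r + c * p^2 * r^2 + d * p * r^3 + e * r^4)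
       (4 * a * p^3 * q + b * (3 * p^2 * q * r + p^3 * s) + c * (2 * p * q * r^2 + 2 * p^2 * r * s)
         + d * (q * r^3 + 3 * p * r^2 * s) + 4 * e * r^3 * s)
       (6 * a * p^2 * q^2 + b * (3 * p * q^2 * r + 3 * p^2 * q * s)
         + c * (q^2 * r^2 + 4 * p * q * r * s + p^2 * s^2)
         + d * (3 * q * r^2 * s + 3 * p * r * s^2) + 6 * e * r^2 * s^2)
       (4 * a * p * q^3 + b * (q^3 * r + 3 * p * q^2 * s) + c * (2 * q^2 * r * s + 2 * p * q * s^2)
         + d * (3 * q * r * s^2 + p * s^3) + 4 * e * r * s^3)
       (a * q^4 + b * q^3 * s + c * q^2 * s^2 + d * q * s^3 + e * s^4)"

lemma eval2_subst2: "eval2 (subst2 f p q r s) x y = eval2 f (p * x + q * y) (r * x + s * y)"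
  by (induction f) (simp, algebra)

lemma eval4_subst4: "eval4 (subst4 F p q r s) x y = eval4 F (p * x + q * y) (r * x + s * y)"
  by (induction F) (simp, algebra)

lemma eval4_mult: "eval4 F (k * x) (k * y) = k^4 * eval4 F x y"
  by (cases F) (simp add: power_mult_distrib algebra_simps eval_nat_numeral)

lemma Delta_subst2: "Delta (subst2 f p q r s) = (p * s - q * r)^2 * Delta f"
  by (induction f) (simp, algebra)

lemma J_inv_subst4: "J_inv (subst4 F p q r s) = (p * s - q * r)^6 * J_inv F"
  by (induction F) (simp, algebra)

text \<open>The invariant of degree two, normalised to fit \<open>J_inv\<close> in the discriminant
  relation below.\<close>

fun I_inv :: "'a::idom quartic \<Rightarrow> 'a" where
  "I_inv (Quartic a b c d e) = 12 * a * e - 3 * b * d + c^2"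

lemma I_inv_subst4: "I_inv (subst4 F p q r s) = (p * s - q * r)^4 * I_inv F"
  by (induction F) (simp, algebra)

lemma disc4_eq_invs: "27 * disc4 F = 4 * I_inv F ^ 3 - J_inv F ^ 2"
  by (induction F) (simp, algebra)

text \<open>One third of the Hessian determinant F_xx F_yy - F_xy^2.\<close>

fun hessian :: "'a::idom quartic \<Rightarrow> 'a quartic" where
  "hessian (Quartic a b c d e) =
     Quartic (8 * a * c - 3 * b^2) (24 * a * d - 4 * b * c)
       (48 * a * e + 6 * b * d - 4 * c^2) (24 * b * e - 4 * c * d) (8 * c * e - 3 * d^2)"

lemma hessian_subst4:
  "hessian (subst4 F p q r s) = map_quartic ((*) ((p * s - q * r)^2)) (subst4 (hessian F) p q r s)"
  by (induction F) (simp, intro conjI; algebra)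

fun eval4_dx :: "'a::idom quartic \<Rightarrow> 'a \<Rightarrow> 'a \<Rightarrow> 'a" where
  "eval4_dx (Quartic a b c d e) x y = 4 * a * x^3 + 3 * b * x^2 * y + 2 * c * x * y^2 + d * y^3"

fun eval4_dy :: "'a::idom quartic \<Rightarrow> 'a \<Rightarrow> 'a \<Rightarrow> 'a" where
  "eval4_dy (Quartic a b c d e) x y = b * x^3 + 2 * c * x^2 * y + 3 * d * x * y^2 + 4 * e * y^3"

lemma eval4_dx_subst4:
  "eval4_dx (subst4 F p q r s) x y =
     p * eval4_dx F (p * x + q * y) (r * x + s * y) + r * eval4_dy F (p * x + q * y) (r * x + s * y)"
  by (induction F) (simp, algebra)

lemma eval4_dy_subst4:
  "eval4_dy (subst4 F p q r s) x y =
     q * eval4_dx F (p * x + q * y) (r * x + s * y) + s * eval4_dy F (p * x + q * y) (r * x + s * y)"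
  by (induction F) (simp, algebra)

lemma eval4_scale:
  "eval4 (map_quartic ((*) k) F) x y = k * eval4 F x y"
  "eval4_dx (map_quartic ((*) k) F) x y = k * eval4_dx F x y"
  "eval4_dy (map_quartic ((*) k) F) x y = k * eval4_dy F x y"
  by (induction F; simp; algebra)+

text \<open>Recognises the explicit sextic as the Jacobian determinant of the form and its Hessian,
  so that the chain rule applies to it.\<close>

lemma sextic_covariant_eq_jacobian:
  "12 * sextic_covariant F x y
     = eval4_dx F x y * eval4_dy (hessian F) x y - eval4_dy F x y * eval4_dx (hessian F) x y"
  by (induction F) (simp, algebra)

text \<open>Two of the three determinant factors come from the Hessian, the third from the
  Jacobian.\<close>

lemma sextic_covariant_subst4:
  fixes F :: "'a::field_char_0 quartic"
  shows "sextic_covariant (subst4 F p q r s) x y =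
    (p * s - q * r)^3 * sextic_covariant F (p * x + q * y) (r * x + s * y)"
proof -
  have "12 * sextic_covariant (subst4 F p q r s) x y =
    12 * ((p * s - q * r)^3 * sextic_covariant F (p * x + q * y) (r * x + s * y))"
    using sextic_covariant_eq_jacobian[of F "p * x + q * y" "r * x + s * y"]
    unfolding sextic_covariant_eq_jacobian[of "subst4 F p q r s"] hessian_subst4 eval4_scale
      eval4_dx_subst4 eval4_dy_subst4
    by algebra
  then show ?thesis by simp
qed

section \<open>Biquadratic normal form\<close>

lemma eval2_inject:
  fixes f g :: "'a::{idom,ring_char_0} quadratic"
  assumes "\<And>x y. eval2 f x y = eval2 g x y"
  shows "f = g"
proof -
  obtain a b c a' b' c' where fg: "f = Quadratic a b c" "g = Quadratic a' b' c'"
    by (cases f, cases g)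
  have "poly [:c, b, a:] x = poly [:c', b', a':] x" for x
    using assms[of x 1] by (simp add: fg algebra_simps power2_eq_square)
  then have "[:c, b, a:] = [:c', b', a':]"
    using poly_eq_poly_eq_iff by blast
  then show ?thesis by (simp add: fg)
qed

lemma eval4_inject:
  fixes F G :: "'a::{idom,ring_char_0} quartic"
  assumes "\<And>x y. eval4 F x y = eval4 G x y"
  shows "F = G"
proof -
  obtain a b c d e a' b' c' d' e'
    where FG: "F = Quartic a b c d e" "G = Quartic a' b' c' d' e'"
    by (cases F, cases G)
  have "poly [:e, d, c, b, a:] x = poly [:e', d', c', b', a':] x" for x
    using assms[of x 1] by (simp add: FG algebra_simps eval_nat_numeral)
  then have "[:e, d, c, b, a:] = [:e', d', c', b', a':]"
    using poly_eq_poly_eq_iff by blast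
  then show ?thesis by (simp add: FG)
qed

text \<open>Composition of substitutions is a matrix product; comparing evaluations avoids expanding
  the coefficients of a double substitution.\<close>

lemma subst4_subst4:
  fixes F :: "'a::{idom,ring_char_0} quartic"
  shows "subst4 (subst4 F p q r s) p' q' r' s' =
    subst4 F (p * p' + q * r') (p * q' + q * s') (r * p' + s * r') (r * q' + s * s')"
  by (rule eval4_inject) (simp add: eval4_subst4 algebra_simps)

lemma subst2_subst2:
  fixes f :: "'a::{idom,ring_char_0} quadratic"
  shows "subst2 (subst2 f p q r s) p' q' r' s' =
    subst2 f (p * p' + q * r') (p * q' + q * s') (r * p' + s * r') (r * q' + s * s')"
  by (rule eval2_inject) (simp add: eval2_subst2 algebra_simps)

lemma subst4_id: "subst4 F 1 0 0 1 = F"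
  by (cases F) simp

lemma subst2_id: "subst2 f 1 0 0 1 = f"
  by (cases f) simp

lemma inverse_entries:
  fixes p q r s :: "'a::field"
  assumes "p * s - q * r \<noteq> 0"
  defines "D \<equiv> p * s - q * r"
  shows "p * (s / D) + q * (- r / D) = 1" "p * (- q / D) + q * (p / D) = 0"
    "r * (s / D) + s * (- r / D) = 0" "r * (- q / D) + s * (p / D) = 1"
    "s / D * p + - q / D * r = 1" "s / D * q + - q / D * s = 0"
    "- r / D * p + p / D * r = 0" "- r / D * q + p / D * s = 1"
proof -
  have "(p * s - q * r) / D = 1" using assms by simp
  then show "p * (s / D) + q * (- r / D) = 1" "p * (- q / D) + q * (p / D) = 0"
    "r * (s / D) + s * (- r / D) = 0" "r * (- q / D) + s * (p / D) = 1"
    "s / D * p + - q / D * r = 1" "s / D * q + - q / D * s = 0"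
    "- r / D * p + p / D * r = 0" "- r / D * q + p / D * s = 1"
    by (simp_all add: diff_divide_distrib mult.commute)
qed

lemma subst4_inverse:
  fixes F :: "'a::field_char_0 quartic"
  assumes "p * s - q * r \<noteq> 0"
  defines "D \<equiv> p * s - q * r"
  shows "subst4 (subst4 F p q r s) (s / D) (- q / D) (- r / D) (p / D) = F"
  using inverse_entries[OF assms(1)] by (simp only: D_def subst4_subst4 subst4_id)

lemma subst2_inverse:
  fixes f :: "'a::field_char_0 quadratic"
  assumes "p * s - q * r \<noteq> 0"
  defines "D \<equiv> p * s - q * r"
  shows "subst2 (subst2 f p q r s) (s / D) (- q / D) (- r / D) (p / D) = f"
    "subst2 (subst2 f (s / D) (- q / D) (- r / D) (p / D)) p q r s = f"
  using inverse_entries[OF assms(1)] by (simp_all only: D_def subst2_subst2 subst2_id)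

lemma subst2_scale: "subst2 (map_quadratic ((*) c) f) p q r s = map_quadratic ((*) c) (subst2 f p q r s)"
  by (cases f) (simp add: algebra_simps)

lemma J_inv_scale: "J_inv (map_quartic ((*) k) F) = k^3 * J_inv F"
  by (cases F) (simp add: algebra_simps eval_nat_numeral)

text \<open>The new cofactor is the substituted one times the cube of the determinant.
  \<open>J_inv\<close> is homogeneous and only gains a power of the determinant, so it stays
  zero.\<close>

lemma significant_factor_subst:
  assumes "significant_factor F f"
  shows "significant_factor (subst4 F p q r s) (subst2 f p q r s)"
proof -
  obtain G where G: "\<And>x y. sextic_covariant F x y = eval2 f x y * eval4 G x y" "J_inv G = 0"
    using assms unfolding significant_factor_def by blast
  show ?thesis
    unfolding significant_factor_def
    by (rule exI[of _ "map_quartic ((*) ((p * s - q * r)^3)) (subst4 G p q r s)"])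
      (simp add: sextic_covariant_subst4 eval2_subst2 eval4_subst4 eval4_scale G J_inv_scale J_inv_subst4)
qed

lemma significant_factor_subst_iff:
  assumes "p * s - q * r \<noteq> 0"
  shows "significant_factor (subst4 F p q r s) (subst2 f p q r s) \<longleftrightarrow> significant_factor F f"
  using significant_factor_subst[of "subst4 F p q r s" "subst2 f p q r s"]
  by (metis significant_factor_subst subst4_inverse[OF assms] subst2_inverse(1)[OF assms])

section \<open>Significant factors of the normal form\<close>

lemma sextic_covariant_biquadratic:
  "sextic_covariant (Quartic 1 0 m 0 1) x y = 8 * (4 - m^2) * (x^5 * y - x * y^5)"
  for m :: "'a::idom"
  by (simp add: algebra_simps)

text \<open>A divisor is a product of two of the linear forms x, y, x \<plusminus> y, x \<plusminus>
  \<i> y. Comparing coefficients of f G with the sextic and splitting by the vanishing of a, b, c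
  sorts these pairs; \<open>J_inv\<close> excludes the mixed ones.\<close>

lemma significant_factor_biquadraticD:
  assumes m: "m^2 \<noteq> 4" and sig: "significant_factor (Quartic 1 0 m 0 1) f"
  shows "\<exists>c. c \<noteq> 0 \<and> (f = Quadratic 0 c 0 \<or> f = Quadratic c 0 (- c) \<or> f = Quadratic c 0 c)"
proof -
  define K where "K = 8 * (4 - m^2)"
  have K: "K \<noteq> 0" using m by (simp add: K_def)
  obtain a b c where f: "f = Quadratic a b c" by (cases f)
  obtain G where G: "\<And>x y. sextic_covariant (Quartic 1 0 m 0 1) x y = eval2 f x y * eval4 G x y"
    and J: "J_inv G = 0"
    using sig unfolding significant_factor_def by blast
  obtain g4 g3 g2 g1 g0 where Geq: "G = Quartic g4 g3 g2 g1 g0" by (cases G)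
  have "poly [:c * g0, c * g1 + b * g0, c * g2 + b * g1 + a * g0, c * g3 + b * g2 + a * g1,
      c * g4 + b * g3 + a * g2, b * g4 + a * g3, a * g4:] x = poly [:0, - K, 0, 0, 0, K, 0:] x" for x
    using G[of x 1] unfolding sextic_covariant_biquadratic K_def[symmetric] f Geq
    by (simp add: algebra_simps eval_nat_numeral)
  then have "[:c * g0, c * g1 + b * g0, c * g2 + b * g1 + a * g0, c * g3 + b * g2 + a * g1,
      c * g4 + b * g3 + a * g2, b * g4 + a * g3, a * g4:] = [:0, - K, 0, 0, 0, K, 0:]"
    using poly_eq_poly_eq_iff by blast
  then have eqs: "c * g0 = 0" "c * g1 + b * g0 = - K" "c * g2 + b * g1 + a * g0 = 0"
    "c * g3 + b * g2 + a * g1 = 0" "c * g4 + b * g3 + a * g2 = 0" "b * g4 + a * g3 = K" "a * g4 = 0"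
    by simp_all
  have J': "72 * g4 * g2 * g0 + 9 * g3 * g2 * g1 - 27 * g4 * g1^2 - 27 * g0 * g3^2 - 2 * g2^3 = 0"
    using J by (simp add: Geq)
  consider "a = 0" "c = 0" | "a = 0" "c \<noteq> 0" | "a \<noteq> 0" "c = 0" | "a \<noteq> 0" "c \<noteq> 0" "b = 0"
    | "a \<noteq> 0" "c \<noteq> 0" "b \<noteq> 0" by blast
  then show ?thesis
  proof cases
    case 1
    then have "b * g4 = K" using eqs(6) by simp
    then have "b \<noteq> 0" using K by force
    then show ?thesis using f 1 by blast
  next
    case 2
    have z: "g0 = 0" using eqs(1) 2 by simp
    \<comment> \<open>Here f = y (b x + c y), and the equations give g2 = -(b/c) g1, g3 = (b/c)^2
      g1, g4 = -(b/c)^3 g1; the factor 20 is 27 - 9 + 2.\<close>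
    have "b^3 * g1^3 * 20 = c^3 * (72 * g4 * g2 * g0 + 9 * g3 * g2 * g1 - 27 * g4 * g1^2 - 27 * g0 * g3^2 - 2 * g2^3)"
      using eqs z 2(1) by algebra
    then have "b^3 * g1^3 * 20 = 0" unfolding J' by simp
    moreover have "c * g1 = - K" "b * g4 = K" using eqs(2,6) z 2(1) by simp_all
    then have "g1 \<noteq> 0" "b \<noteq> 0" using K by force+
    ultimately show ?thesis by simp
  next
    \<comment> \<open>The mirror image of the previous case under exchange of x and y, with f = x (a
      x + b y).\<close>
    case 3
    have z: "g4 = 0" using eqs(7) 3 by simp
    have "b^3 * g3^3 * 20 = a^3 * (72 * g4 * g2 * g0 + 9 * g3 * g2 * g1 - 27 * g4 * g1^2 - 27 * g0 * g3^2 - 2 * g2^3)"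
      using eqs z 3(2) by algebra
    then have "b^3 * g3^3 * 20 = 0" unfolding J' by simp
    moreover have "a * g3 = K" "b * g0 = - K" using eqs(2,6) z 3(2) by simp_all
    then have "g3 \<noteq> 0" "b \<noteq> 0" using K by force+
    ultimately show ?thesis by simp
  next
    case 4
    have z: "g0 = 0" "g4 = 0" using eqs(1,7) 4 by simp_all
    have "K * (c^2 - a^2) = 0" using eqs z 4(3) by algebra
    then have "(c - a) * (c + a) = 0" using K by (simp add: algebra_simps power2_eq_square)
    then have "c = a \<or> c = - a" by (simp add: eq_neg_iff_add_eq_0)
    then show ?thesis using f 4 by auto
  next
    \<comment> \<open>Such an f pairs a factor of x^2 - y^2 with one of x^2 + y^2, for example (x -
      y)(x - \<i> y). Divisibility gives b^4 = 4 a^2 c^2 and \<open>J_inv\<close> adds 9 a c = 2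
      b^2; together they are contradictory.\<close>
    case 5
    have z: "g0 = 0" "g4 = 0" using eqs(1,7) 5 by simp_all
    have "c * g1 = - K" "a * g3 = K" using eqs(2,6) z by simp_all
    then have nz: "g1 \<noteq> 0" "g3 \<noteq> 0" using K by force+
    have 1: "b * g1 = - c * g2" "b * g3 = - a * g2"
      using eqs(3,5) z by algebra+
    have g2: "g2 \<noteq> 0"
    proof
      assume "g2 = 0"
      then have "b * g1 = 0" using 1(1) by simp
      then show False using nz 5 by simp
    qed
    have "b * (c * g3 - a * g1) = 0" using 1 by algebra
    then have 2: "c * g3 = a * g1" using 5 by simp
    have 3: "b * g2 = - 2 * c * g3" "b * g2 = - 2 * a * g1"
      using eqs(4) 2 by algebra+
    have "g2 * (9 * g3 * g1 - 2 * g2^2) = 0" using J' z by algebra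
    then have 4: "9 * g3 * g1 = 2 * g2^2" using g2 by simp
    have 5: "a * c * g2^2 = b^2 * g3 * g1" using 1 by algebra
    have 6: "b^2 * g2^2 = 4 * a * c * g3 * g1" using 3 by algebra
    have "(g3 * g1) * (9 * a * c - 2 * b^2) = 0" using 4 5 by algebra
    then have 7: "9 * a * c = 2 * b^2" using nz by simp
    have "(g3 * g1) * (b^4 - 4 * a^2 * c^2) = 0" using 5 6 by algebra
    then have 8: "b^4 = 4 * a^2 * c^2" using nz by simp
    \<comment> \<open>Squaring gives 81 (a c)^2 = 4 b^4 = 16 (a c)^2.\<close>
    have "65 * (a * c)^2 = 0" using 7 8 by algebra
    then show ?thesis using 5 \<open>a \<noteq> 0\<close> \<open>c \<noteq> 0\<close> by simp
  qed
qed

text \<open>The cofactors x^4 - y^4, x y (x^2 + y^2) and x y (x^2 - y^2) have so few terms that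
  every monomial of \<open>J_inv\<close> vanishes.\<close>

lemma significant_factor_biquadraticI:
  assumes c: "c \<noteq> 0"
  shows "significant_factor (Quartic 1 0 m 0 1) (Quadratic 0 c 0)"
    "significant_factor (Quartic 1 0 m 0 1) (Quadratic c 0 (- c))"
    "significant_factor (Quartic 1 0 m 0 1) (Quadratic c 0 c)"
proof -
  define k where "k = 8 * (4 - m^2) / c"
  have "8 * (4 - m^2) = c * k" using c by (simp add: k_def)
  then have *: "sextic_covariant (Quartic 1 0 m 0 1) x y = c * k * (x^5 * y - x * y^5)" for x y
    by (simp only: sextic_covariant_biquadratic)
  show "significant_factor (Quartic 1 0 m 0 1) (Quadratic 0 c 0)"
    unfolding significant_factor_def *
    by (rule exI[of _ "Quartic k 0 0 0 (- k)"]) (simp add: algebra_simps eval_nat_numeral)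
  show "significant_factor (Quartic 1 0 m 0 1) (Quadratic c 0 (- c))"
    unfolding significant_factor_def *
    by (rule exI[of _ "Quartic 0 k 0 k 0"]) (simp add: algebra_simps eval_nat_numeral)
  show "significant_factor (Quartic 1 0 m 0 1) (Quadratic c 0 c)"
    unfolding significant_factor_def *
    by (rule exI[of _ "Quartic 0 k 0 (- k) 0"]) (simp add: algebra_simps eval_nat_numeral)
qed

text \<open>The condition m^2 \<noteq> 4 says that the discriminant 16 (m^2 - 4)^2 of x^4 + m x^2
  y^2 + y^4 is not zero.\<close>

definition biquadratic_equiv :: "complex quartic \<Rightarrow> bool" where
  "biquadratic_equiv F \<longleftrightarrow>
     (\<exists>m p q r s. m^2 \<noteq> 4 \<and> p * s - q * r \<noteq> 0 \<and> F = subst4 (Quartic 1 0 m 0 1) p q r s)"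

lemma biquadratic_equiv_subst4:
  assumes "biquadratic_equiv F" "p * s - q * r \<noteq> 0"
  shows "biquadratic_equiv (subst4 F p q r s)"
proof -
  obtain m p' q' r' s' where m: "m^2 \<noteq> 4" and D: "p' * s' - q' * r' \<noteq> 0"
    and F: "F = subst4 (Quartic 1 0 m 0 1) p' q' r' s'"
    using assms(1) unfolding biquadratic_equiv_def by blast
  have "(p' * p + q' * r) * (r' * q + s' * s) - (p' * q + q' * s) * (r' * p + s' * r)
      = (p' * s' - q' * r') * (p * s - q * r)"
    by (simp add: algebra_simps)
  also have "\<dots> \<noteq> 0" using D assms(2) by simp
  finally show ?thesis
    unfolding biquadratic_equiv_def F subst4_subst4 using m by blast
qed

lemma ex_fourth_root: "\<exists>k::complex. k^4 = z"
proof
  have "w^4 = (w^2)^2" for w :: complex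
    by (simp flip: power_mult)
  from this[of "csqrt (csqrt z)"] show "csqrt (csqrt z) ^ 4 = z" by simp
qed

text \<open>Scaling x and y by fourth roots absorbs the outer coefficients; the condition on \<beta>
  turns into m^2 \<noteq> 4.\<close>

lemma biquadratic_equiv_even:
  assumes "\<alpha> \<noteq> 0" "\<gamma> \<noteq> 0" "\<beta>^2 \<noteq> 4 * \<alpha> * \<gamma>"
  shows "biquadratic_equiv (Quartic \<alpha> 0 \<beta> 0 \<gamma>)"
proof -
  obtain k l where kl: "k^4 = \<alpha>" "l^4 = \<gamma>" using ex_fourth_root by metis
  have nz: "k \<noteq> 0" "l \<noteq> 0" using kl assms by auto
  define m where "m = \<beta> / (k^2 * l^2)"
  have \<beta>: "\<beta> = m * k^2 * l^2" using nz by (simp add: m_def)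
  have "m^2 \<noteq> 4"
  proof
    assume "m^2 = 4"
    then have "\<beta>^2 = 4 * \<alpha> * \<gamma>"
      unfolding \<beta> kl[symmetric] by (simp add: power_mult_distrib flip: power_mult)
    then show False using assms by simp
  qed
  moreover have "Quartic \<alpha> 0 \<beta> 0 \<gamma> = subst4 (Quartic 1 0 m 0 1) k 0 0 l"
    by (simp add: \<beta> kl)
  moreover have "k * l - 0 * 0 \<noteq> 0" using nz by simp
  ultimately show ?thesis unfolding biquadratic_equiv_def by blast
qed

text \<open>Scaling by square roots of A and C makes the form symmetric, X Y (X^2 + t X Y + Y^2) /
  (a c). In the coordinates u = (X + Y)/2 and v = (X - Y)/2 only even powers remain.\<close>

lemma biquadratic_equiv_xy:
  assumes "A \<noteq> 0" "C \<noteq> 0" "B^2 \<noteq> 4 * A * C"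
  shows "biquadratic_equiv (Quartic 0 A B C 0)"
proof -
  obtain a c where ac: "a^2 = A" "c^2 = C" using power2_csqrt by metis
  have nz: "a \<noteq> 0" "c \<noteq> 0" using ac assms by auto
  define t where "t = B / (a * c)"
  have B: "B = t * a * c" using nz by (simp add: t_def)
  have t: "t^2 \<noteq> 4"
  proof
    assume "t^2 = 4"
    then have "B^2 = 4 * A * C" unfolding B ac[symmetric] by (simp add: power_mult_distrib)
    then show False using assms by simp
  qed
  have t': "2 + t \<noteq> 0" "t - 2 \<noteq> 0"
  proof -
    have "(2 + t) * (t - 2) \<noteq> 0" using t by (simp add: algebra_simps power2_eq_square)
    then show "2 + t \<noteq> 0" "t - 2 \<noteq> 0" by auto
  qed
  \<comment> \<open>With X = u + v and Y = u - v the form is (u^2 - v^2) ((2 + t) u^2 + (2 - t) v^2)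
    / (a c).\<close>
  have "biquadratic_equiv (Quartic ((2 + t) / (a * c)) 0 (- 2 * t / (a * c)) 0 ((t - 2) / (a * c)))"
  proof (rule biquadratic_equiv_even)
    show "(2 + t) / (a * c) \<noteq> 0" "(t - 2) / (a * c) \<noteq> 0" using t' nz by auto
    show "(- 2 * t / (a * c))^2 \<noteq> 4 * ((2 + t) / (a * c)) * ((t - 2) / (a * c))"
      using nz by (simp add: field_simps power2_eq_square)
  qed
  then have "biquadratic_equiv (subst4 (Quartic ((2 + t) / (a * c)) 0 (- 2 * t / (a * c)) 0 ((t - 2) / (a * c)))
      (a / 2) (c / 2) (a / 2) (- c / 2))"
    by (rule biquadratic_equiv_subst4) (use nz in simp)
  also have "subst4 (Quartic ((2 + t) / (a * c)) 0 (- 2 * t / (a * c)) 0 ((t - 2) / (a * c)))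
      (a / 2) (c / 2) (a / 2) (- c / 2) = Quartic 0 A B C 0"
    unfolding B ac[symmetric] using nz
    by (simp add: field_simps eval_nat_numeral)
  finally show ?thesis .
qed

section \<open>Automorphisms and significant factors\<close>

lemma quartic_linear_factor:
  fixes a b c d e :: complex
  obtains p q a' b' c' d' where "a = p * a'" "b = q * a' + p * b'" "c = q * b' + p * c'"
    "d = q * c' + p * d'" "e = q * d'"
proof (cases "a = 0")
  \<comment> \<open>The root lies at infinity: the linear factor is y.\<close>
  case True
  then show ?thesis using that[of 0 b 1 c d e] by simp
next
  case False
  then have "\<not> constant (poly [:e, d, c, b, a:])"
    by (simp add: constant_degree)
  then obtain z where z: "poly [:e, d, c, b, a:] z = 0"
    using fundamental_theorem_of_algebra by blast
  then have "e = - z * (d + z * (c + z * (b + z * a)))"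
    by (simp add: eq_neg_iff_add_eq_0)
  \<comment> \<open>Synthetic division: the Horner sums at z are the coefficients of the cubic
    cofactor.\<close>
  then show ?thesis
    by (intro that[of 1 a "- z" "b + z * a" "c + z * (b + z * a)" "d + z * (c + z * (b + z * a))"])
      simp_all
qed

text \<open>The roots are split off one after the other. The coefficients are kept in the shape of
  \<open>disc4_eq_prod\<close>, so that the discriminant becomes a product of 2 by 2
  determinants.\<close>

lemma quartic_split:
  fixes F :: "complex quartic"
  obtains p1 q1 p2 q2 p3 q3 p4 q4 where
    "F = Quartic
      (p1 * p2 * p3 * p4)
      (q1 * p2 * p3 * p4 + p1 * q2 * p3 * p4 + p1 * p2 * q3 * p4 + p1 * p2 * p3 * q4)
      (q1 * q2 * p3 * p4 + q1 * p2 * q3 * p4 + q1 * p2 * p3 * q4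
        + p1 * q2 * q3 * p4 + p1 * q2 * p3 * q4 + p1 * p2 * q3 * q4)
      (p1 * q2 * q3 * q4 + q1 * p2 * q3 * q4 + q1 * q2 * p3 * q4 + q1 * q2 * q3 * p4)
      (q1 * q2 * q3 * q4)"
proof -
  obtain a b c d e where F: "F = Quartic a b c d e" by (cases F)
  obtain p1 q1 a1 b1 c1 d1 where 1: "a = p1 * a1" "b = q1 * a1 + p1 * b1" "c = q1 * b1 + p1 * c1"
    "d = q1 * c1 + p1 * d1" "e = q1 * d1"
    by (rule quartic_linear_factor)
  have cubic: "\<exists>p q A B C. (a::complex) = p * A \<and> b = q * A + p * B \<and> c = q * B + p * C \<and> d = q * C"
    for a b c d
  proof (cases "a = 0")
    case True
    then show ?thesis by (intro exI[of _ 0] exI[of _ 1] exI[of _ b] exI[of _ c] exI[of _ d]) simp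
  next
    case False
    then have "\<not> constant (poly [:d, c, b, a:])"
      by (simp add: constant_degree)
    then obtain z where z: "poly [:d, c, b, a:] z = 0"
      using fundamental_theorem_of_algebra by blast
    then have "d = - z * (c + z * (b + z * a))"
      by (simp add: eq_neg_iff_add_eq_0)
    then show ?thesis
      by (intro exI[of _ 1] exI[of _ "- z"] exI[of _ a] exI[of _ "b + z * a"]
          exI[of _ "c + z * (b + z * a)"]) simp
  qed
  have quadr: "\<exists>p q A B. (a::complex) = p * A \<and> b = q * A + p * B \<and> c = q * B" for a b c
  proof (cases "a = 0")
    case True
    then show ?thesis by (intro exI[of _ 0] exI[of _ 1] exI[of _ b] exI[of _ c]) simp
  next
    case False
    then have "\<not> constant (poly [:c, b, a:])"
      by (simp add: constant_degree)
    then obtain z where z: "poly [:c, b, a:] z = 0"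
      using fundamental_theorem_of_algebra by blast
    then have "c = - z * (b + z * a)"
      by (simp add: eq_neg_iff_add_eq_0)
    then show ?thesis
      by (intro exI[of _ 1] exI[of _ "- z"] exI[of _ a] exI[of _ "b + z * a"]) simp
  qed
  obtain p2 q2 a2 b2 c2 where 2: "a1 = p2 * a2" "b1 = q2 * a2 + p2 * b2" "c1 = q2 * b2 + p2 * c2"
    "d1 = q2 * c2" using cubic by blast
  obtain p3 q3 a3 b3 where 3: "a2 = p3 * a3" "b2 = q3 * a3 + p3 * b3" "c2 = q3 * b3"
    using quadr by blast
  show ?thesis
    by (rule that[of p1 p2 p3 a3 q1 q2 q3 b3]) (simp add: F 1 2 3 algebra_simps)
qed

text \<open>The non-zero discriminant makes the first two linear factors independent, so they serve
  as new coordinates. In these F is x y (\<alpha> x + \<beta> y) (\<gamma> x + \<delta> y).\<close>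

lemma biquadratic_equiv_disc4:
  assumes "disc4 F \<noteq> 0"
  shows "biquadratic_equiv F"
proof -
  obtain p1 q1 p2 q2 p3 q3 p4 q4 where F: "F = Quartic
      (p1 * p2 * p3 * p4)
      (q1 * p2 * p3 * p4 + p1 * q2 * p3 * p4 + p1 * p2 * q3 * p4 + p1 * p2 * p3 * q4)
      (q1 * q2 * p3 * p4 + q1 * p2 * q3 * p4 + q1 * p2 * p3 * q4
        + p1 * q2 * q3 * p4 + p1 * q2 * p3 * q4 + p1 * p2 * q3 * q4)
      (p1 * q2 * q3 * q4 + q1 * p2 * q3 * q4 + q1 * q2 * p3 * q4 + q1 * q2 * q3 * p4)
      (q1 * q2 * q3 * q4)"
    by (rule quartic_split)
  have nz: "p1 * q2 - p2 * q1 \<noteq> 0" "p1 * q3 - p3 * q1 \<noteq> 0" "p1 * q4 - p4 * q1 \<noteq> 0"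
    "p2 * q3 - p3 * q2 \<noteq> 0" "p2 * q4 - p4 * q2 \<noteq> 0" "p3 * q4 - p4 * q3 \<noteq> 0"
    using assms unfolding F disc4_eq_prod by auto
  define D where "D = p1 * q2 - p2 * q1"
  have D: "D \<noteq> 0" using nz by (simp add: D_def)
  \<comment> \<open>Cramer's rule, expressing the last two linear factors by the first two.\<close>
  define \<alpha> \<beta> where "\<alpha> = (p3 * q2 - p2 * q3) / D" and "\<beta> = (p1 * q3 - p3 * q1) / D"
  define \<gamma> \<delta> where "\<gamma> = (p4 * q2 - p2 * q4) / D" and "\<delta> = (p1 * q4 - p4 * q1) / D"
  have coeffs: "\<alpha> * D = p3 * q2 - p2 * q3" "\<beta> * D = p1 * q3 - p3 * q1"
    "\<gamma> * D = p4 * q2 - p2 * q4" "\<delta> * D = p1 * q4 - p4 * q1"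
    using D by (simp_all add: \<alpha>_def \<beta>_def \<gamma>_def \<delta>_def)
  then have nz': "\<alpha> \<noteq> 0" "\<beta> \<noteq> 0" "\<gamma> \<noteq> 0" "\<delta> \<noteq> 0"
    using nz by auto
  have "D * p3 = D * (\<alpha> * p1 + \<beta> * p2)" "D * q3 = D * (\<alpha> * q1 + \<beta> * q2)"
    "D * p4 = D * (\<gamma> * p1 + \<delta> * p2)" "D * q4 = D * (\<gamma> * q1 + \<delta> * q2)"
    using coeffs D_def by algebra+
  then have pq: "p3 = \<alpha> * p1 + \<beta> * p2" "q3 = \<alpha> * q1 + \<beta> * q2"
    "p4 = \<gamma> * p1 + \<delta> * p2" "q4 = \<gamma> * q1 + \<delta> * q2"
    using D by simp_all
  \<comment> \<open>The quadratic cofactor has discriminant (\<alpha> \<delta> - \<beta>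
    \<gamma>)^2, so independence of the last two factors is the remaining condition of
    \<open>biquadratic_equiv_xy\<close>.\<close>
  have "p3 * q4 - p4 * q3 = (\<alpha> * \<delta> - \<beta> * \<gamma>) * D"
    unfolding pq D_def by (simp add: algebra_simps)
  then have "(\<alpha> * \<delta> - \<beta> * \<gamma>)^2 \<noteq> 0" using nz by auto
  then have "(\<alpha> * \<delta> + \<beta> * \<gamma>)^2 \<noteq> 4 * (\<alpha> * \<gamma>) * (\<beta> * \<delta>)"
    by (simp add: algebra_simps power2_eq_square)
  then have "biquadratic_equiv (Quartic 0 (\<alpha> * \<gamma>) (\<alpha> * \<delta> + \<beta> * \<gamma>) (\<beta> * \<delta>) 0)"
    using nz' by (intro biquadratic_equiv_xy) simp_all
  then have "biquadratic_equiv
      (subst4 (Quartic 0 (\<alpha> * \<gamma>) (\<alpha> * \<delta> + \<beta> * \<gamma>) (\<beta> * \<delta>) 0) p1 q1 p2 q2)"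
    by (rule biquadratic_equiv_subst4) (use nz in \<open>simp add: mult.commute\<close>)
  also have "subst4 (Quartic 0 (\<alpha> * \<gamma>) (\<alpha> * \<delta> + \<beta> * \<gamma>) (\<beta> * \<delta>) 0) p1 q1 p2 q2 = F"
    unfolding F pq by (simp add: algebra_simps eval_nat_numeral)
  finally show ?thesis .
qed

lemma significant_factor_scale:
  assumes "c \<noteq> 0"
  shows "significant_factor F (map_quadratic ((*) c) f) \<longleftrightarrow> significant_factor F f"
proof -
  have imp: "significant_factor F f" if sig: "significant_factor F g" and g: "g = map_quadratic ((*) c) f" for c f g
  proof -
    obtain G where G: "\<And>x y. sextic_covariant F x y = eval2 g x y * eval4 G x y" "J_inv G = 0"
      using sig unfolding significant_factor_def by blast
    have "eval2 g x y = c * eval2 f x y" for x y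
      unfolding g by (cases f) (simp add: algebra_simps)
    with G show ?thesis
      unfolding significant_factor_def
      by (intro exI[of _ "map_quartic ((*) c) G"]) (simp add: eval4_scale J_inv_scale)
  qed
  have "map_quadratic ((*) (1 / c)) (map_quadratic ((*) c) f) = f"
    using assms by (cases f) simp
  then show ?thesis using imp by metis
qed

section \<open>Automorphisms of determinant 1 or -1, and the matrices of the significant
  factors\<close>

lemma hessian_biquadratic: "hessian (Quartic 1 0 m 0 1) = Quartic (8 * m) 0 (48 - 4 * m^2) 0 (8 * m)"
  by simp

text \<open>
  Besides the form, an automorphism of determinant \<open>\<plusminus>1\<close> preserves its Hessian, hence the square
  \<open>x\<^sup>2 y\<^sup>2\<close> in the pencil spanned by both.
\<close>
lemma biquadratic_automorphism:
  fixes m :: complex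
  assumes m: "m^2 \<noteq> 4" and inv: "subst4 (Quartic 1 0 m 0 1) t u v w = Quartic 1 0 m 0 1"
    and det: "(t * w - u * v)^2 = 1"
  shows "u = 0 \<and> v = 0 \<and> w = t \<or>
    t + w = 0 \<and> significant_factor (Quartic 1 0 m 0 1) (Quadratic v (w - t) (- u))"
proof -
  have "hessian (Quartic 1 0 m 0 1) = map_quartic ((*) 1) (subst4 (hessian (Quartic 1 0 m 0 1)) t u v w)"
    using hessian_subst4[of "Quartic 1 0 m 0 1" t u v w] unfolding inv det .
  then have hess: "eval4 (hessian (Quartic 1 0 m 0 1)) x y
      = eval4 (hessian (Quartic 1 0 m 0 1)) (t * x + u * y) (v * x + w * y)" for x y
    using eval4_subst4[of "hessian (Quartic 1 0 m 0 1)" t u v w x y] eval4_scale(1)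
    by (metis mult_1)
  have form: "eval4 (Quartic 1 0 m 0 1) x y
      = eval4 (Quartic 1 0 m 0 1) (t * x + u * y) (v * x + w * y)" for x y
    using eval4_subst4[of "Quartic 1 0 m 0 1" t u v w x y] unfolding inv .
  have "eval4 (subst4 (Quartic 0 0 1 0 0) t u v w) x y = eval4 (Quartic 0 0 1 0 0) x y" for x y
  proof -
    define X Y where "X = t * x + u * y" and "Y = v * x + w * y"
    \<comment> \<open>Subtracting 8 m times the form cancels the outer coefficients of its
      Hessian.\<close>
    have "eval4 (Quartic (8 * m) 0 (48 - 4 * m^2) 0 (8 * m)) x' y' - 8 * m * eval4 (Quartic 1 0 m 0 1) x' y'
        = (12 * (4 - m^2)) * (x'^2 * y'^2)" for x' y'
      by (simp add: algebra_simps power2_eq_square)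
    then have "(12 * (4 - m^2)) * (X^2 * Y^2) = (12 * (4 - m^2)) * (x^2 * y^2)"
      using hess[of x y] form[of x y] unfolding X_def Y_def hessian_biquadratic by metis
    moreover have "12 * (4 - m^2) \<noteq> 0" using m by simp
    ultimately have "X^2 * Y^2 = x^2 * y^2" by simp
    then show ?thesis unfolding eval4_subst4 X_def Y_def by simp
  qed
  then have "subst4 (Quartic 0 0 1 0 0) t u v w = Quartic 0 0 1 0 0"
    by (rule eval4_inject)
  then have tv: "t * v = 0" and uw: "u * w = 0"
    and mid: "u^2 * v^2 + 4 * t * u * v * w + t^2 * w^2 = 1"
    by (auto simp: mult_ac)
  have ends: "t^4 + m * t^2 * v^2 + v^4 = 1"
    using inv by simp
  show ?thesis
  proof (cases "v = 0")
    case True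
    with mid have tw: "t^2 * w^2 = 1" by simp
    then have "w \<noteq> 0" "t \<noteq> 0" by auto
    with uw have u: "u = 0" by simp
    \<comment> \<open>Diagonal case: t^2 w^2 = 1 and the end coefficient t^4 = 1 leave w = t, a
      scalar, or w = -t, a multiple of the matrix of x y.\<close>
    have "t^2 * (t^2 - w^2) = 0" using tw ends True by (simp add: algebra_simps flip: power_add)
    then have "w^2 = t^2" using \<open>t \<noteq> 0\<close> by simp
    then consider "w = t" | "w = - t" using power2_eq_iff by blast
    then show ?thesis
    proof cases
      case 2
      then show ?thesis
        using u True \<open>t \<noteq> 0\<close> significant_factor_biquadraticI(1)[of "w - t" m] by simp
    qed (use u True in simp)
  next
    case False
    with tv have t: "t = 0" by simp
    with mid have uv: "u^2 * v^2 = 1" by simp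
    then have "u \<noteq> 0" by auto
    with uw have w: "w = 0" by simp
    \<comment> \<open>Antidiagonal case: u = v belongs to x^2 - y^2 and u = -v to x^2 + y^2.\<close>
    have "v^2 * (v^2 - u^2) = 0" using uv ends t by (simp add: algebra_simps flip: power_add)
    then have "u^2 = v^2" using False by simp
    then consider "u = v" | "u = - v" using power2_eq_iff by blast
    then show ?thesis
      using t w False significant_factor_biquadraticI(2,3)[of v m] by cases simp_all
  qed
qed

text \<open>Conjugation by the change of variables moves the automorphism to the normal form and
  keeps trace and determinant. The quadratic form with coefficients v, w - t, -u is det(z, T z), so
  its pullback acquires just the factor \<open>D\<close>.\<close>

lemma automorphism_cases:
  assumes F: "biquadratic_equiv F" and inv: "subst4 F t u v w = F" and det: "(t * w - u * v)^2 = 1"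
  shows "u = 0 \<and> v = 0 \<and> w = t \<or> t + w = 0 \<and> significant_factor F (Quadratic v (w - t) (- u))"
proof -
  obtain m p q r s where m: "m^2 \<noteq> 4" and D: "p * s - q * r \<noteq> 0"
    and Feq: "F = subst4 (Quartic 1 0 m 0 1) p q r s"
    using F unfolding biquadratic_equiv_def by blast
  define D where "D = p * s - q * r"
  define t' u' v' w' where
    "t' = (p * t + q * v) * (s / D) + (p * u + q * w) * (- r / D)" and
    "u' = (p * t + q * v) * (- q / D) + (p * u + q * w) * (p / D)" and
    "v' = (r * t + s * v) * (s / D) + (r * u + s * w) * (- r / D)" and
    "w' = (r * t + s * v) * (- q / D) + (r * u + s * w) * (p / D)"
  note defs = t'_def u'_def v'_def w'_def
  have "Quartic 1 0 m 0 1 = subst4 F (s / D) (- q / D) (- r / D) (p / D)"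
    unfolding Feq D_def by (rule subst4_inverse[OF D, symmetric])
  also have "\<dots> = subst4 (subst4 F t u v w) (s / D) (- q / D) (- r / D) (p / D)"
    by (simp only: inv)
  also have "\<dots> = subst4 (Quartic 1 0 m 0 1) t' u' v' w'"
    unfolding Feq subst4_subst4 defs ..
  finally have inv': "subst4 (Quartic 1 0 m 0 1) t' u' v' w' = Quartic 1 0 m 0 1" ..
  have D': "D \<noteq> 0" using D by (simp add: D_def)
  have e: "t' * D = (p * t + q * v) * s - (p * u + q * w) * r"
    "u' * D = (p * u + q * w) * p - (p * t + q * v) * q"
    "v' * D = (r * t + s * v) * s - (r * u + s * w) * r"
    "w' * D = (r * u + s * w) * p - (r * t + s * v) * q"
    using D' by (simp_all add: defs field_simps)
  have "D^2 * (t' * w' - u' * v') = D^2 * (t * w - u * v)"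
    using e D_def by algebra
  then have "(t' * w' - u' * v')^2 = 1" using D' det by simp
  note cases = biquadratic_automorphism[OF m inv' this]
  have "D * (t' + w') = D * (t + w)" using e D_def by algebra
  then have tr: "t' + w' = t + w" using D' by simp
  show ?thesis
    using cases
  proof
    assume sc: "u' = 0 \<and> v' = 0 \<and> w' = t'"
    have "D * (D * v) = 0" "D * (D * u) = 0" "D * (D * (w - t)) = 0"
      using e D_def sc by algebra+
    then show ?thesis using D' by simp
  next
    assume *: "t' + w' = 0 \<and> significant_factor (Quartic 1 0 m 0 1) (Quadratic v' (w' - t') (- u'))"
    then have "significant_factor F (subst2 (Quadratic v' (w' - t') (- u')) p q r s)"
      unfolding Feq by (intro significant_factor_subst) simp
    also have "subst2 (Quadratic v' (w' - t') (- u')) p q r s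
        = map_quadratic ((*) D) (Quadratic v (w - t) (- u))"
    proof -
      have "D * (v' * p^2 + (w' - t') * p * r + (- u') * r^2) = D * (D * v)"
        "D * (2 * v' * p * q + (w' - t') * (p * s + q * r) + 2 * (- u') * r * s) = D * (D * (w - t))"
        "D * (v' * q^2 + (w' - t') * q * s + (- u') * s^2) = D * (D * (- u))"
        using e D_def by algebra+
      then have "v' * p^2 + (w' - t') * p * r + (- u') * r^2 = D * v"
        "2 * v' * p * q + (w' - t') * (p * s + q * r) + 2 * (- u') * r * s = D * (w - t)"
        "v' * q^2 + (w' - t') * q * s + (- u') * s^2 = D * (- u)"
        unfolding mult_left_cancel[OF D'] .
      then show ?thesis by simp
    qed
    finally show ?thesis
      using * tr by (simp only: significant_factor_scale[OF D']) simp
  qed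
qed

text \<open>The matrix (b, 2c; -2a, -b) is left without the normalising root, so no complex square
  root has to be chosen. For the three divisors of the normal form the identity is a computation,
  which the change of variables transports.\<close>

lemma significant_factor_automorphism:
  assumes F: "biquadratic_equiv F" and sig: "significant_factor F (Quadratic a b c)"
  shows "Delta (Quadratic a b c) \<noteq> 0"
    "eval4 F (b * x + 2 * c * y) (- 2 * a * x - b * y) = Delta (Quadratic a b c)^2 * eval4 F x y"
proof -
  obtain m p q r s where m: "m^2 \<noteq> 4" and D: "p * s - q * r \<noteq> 0"
    and Feq: "F = subst4 (Quartic 1 0 m 0 1) p q r s"
    using F unfolding biquadratic_equiv_def by blast
  define D where "D = p * s - q * r"
  obtain a' b' c' where
    f': "subst2 (Quadratic a b c) (s / D) (- q / D) (- r / D) (p / D) = Quadratic a' b' c'"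
    by (metis quadratic.exhaust)
  then have f: "Quadratic a b c = subst2 (Quadratic a' b' c') p q r s"
    using subst2_inverse(2)[OF D] unfolding D_def by metis
  then have "significant_factor (Quartic 1 0 m 0 1) (Quadratic a' b' c')"
    using sig unfolding Feq by (simp only: significant_factor_subst_iff[OF D])
  then obtain k where k: "k \<noteq> 0" and fk: "Quadratic a' b' c' = Quadratic 0 k 0
      \<or> Quadratic a' b' c' = Quadratic k 0 (- k) \<or> Quadratic a' b' c' = Quadratic k 0 k"
    using significant_factor_biquadraticD[OF m] by blast
  have \<Delta>: "Delta (Quadratic a b c) = D^2 * Delta (Quadratic a' b' c')"
    unfolding f Delta_subst2 D_def ..
  show "Delta (Quadratic a b c) \<noteq> 0"
    unfolding \<Delta> using k fk D by (auto simp: D_def)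
  have H: "eval4 (Quartic 1 0 m 0 1) (b' * X + 2 * c' * Y) (- 2 * a' * X - b' * Y)
      = Delta (Quadratic a' b' c')^2 * eval4 (Quartic 1 0 m 0 1) X Y" for X Y
    using fk by (auto simp: algebra_simps eval_nat_numeral)
  define X Y where "X = p * x + q * y" and "Y = r * x + s * y"
  have abc: "a = a' * p^2 + b' * p * r + c' * r^2"
    "b = 2 * a' * p * q + b' * (p * s + q * r) + 2 * c' * r * s"
    "c = a' * q^2 + b' * q * s + c' * s^2"
    using f by simp_all
  \<comment> \<open>The map of f is its skew gradient (f_y, -f_x), which is therefore conjugated by
    the change of variables up to the determinant.\<close>
  have "p * (b * x + 2 * c * y) + q * (- 2 * a * x - b * y) = D * (b' * X + 2 * c' * Y)"
    "r * (b * x + 2 * c * y) + s * (- 2 * a * x - b * y) = D * (- 2 * a' * X - b' * Y)"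
    unfolding abc D_def X_def Y_def by algebra+
  then have "eval4 F (b * x + 2 * c * y) (- 2 * a * x - b * y)
      = D^4 * eval4 (Quartic 1 0 m 0 1) (b' * X + 2 * c' * Y) (- 2 * a' * X - b' * Y)"
    unfolding Feq eval4_subst4 by (simp only: eval4_mult)
  also have "\<dots> = (D^2 * Delta (Quadratic a' b' c'))^2 * eval4 (Quartic 1 0 m 0 1) X Y"
    unfolding H by (simp add: power_mult_distrib flip: power_mult)
  also have "eval4 (Quartic 1 0 m 0 1) X Y = eval4 F x y"
    unfolding Feq eval4_subst4 X_def Y_def ..
  finally show "eval4 F (b * x + 2 * c * y) (- 2 * a * x - b * y) = Delta (Quadratic a b c)^2 * eval4 F x y"
    unfolding \<Delta> .
qed

section \<open>The three significant factors\<close>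

lemma map_quadratic_scale_scale:
  "map_quadratic ((*) c) (map_quadratic ((*) d) f) = map_quadratic ((*) (c * d)) f"
  for c d :: "'a::comm_ring_1"
  by (cases f) (simp add: mult.assoc)

lemma proportional_scale:
  assumes "c \<noteq> 0"
  shows "proportional (map_quadratic ((*) c) f) f"
  unfolding proportional_def using assms by blast

lemma proportional_sym:
  fixes f g :: "'a::field quadratic"
  assumes "proportional f g"
  shows "proportional g f"
proof -
  obtain c where c: "c \<noteq> 0" "f = map_quadratic ((*) c) g"
    using assms unfolding proportional_def by blast
  then have "g = map_quadratic ((*) (1 / c)) f"
    by (cases g) simp
  then show ?thesis using c unfolding proportional_def by (metis divide_eq_0_iff zero_neq_one)
qed

lemma proportional_trans:
  fixes f g h :: "'a::idom quadratic"
  assumes "proportional f g" "proportional g h"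
  shows "proportional f h"
  using assms unfolding proportional_def by (metis map_quadratic_scale_scale mult_eq_0_iff)

lemma significant_factor_proportional:
  assumes "proportional f g"
  shows "significant_factor F f \<longleftrightarrow> significant_factor F g"
  using assms significant_factor_scale unfolding proportional_def by blast

lemma eval2_scale: "eval2 (map_quadratic ((*) c) f) x y = c * eval2 f x y"
  for c :: "'a::comm_ring_1"
  by (cases f) (simp add: algebra_simps)

text \<open>The symmetric bilinear form with \<open>polar f f = Delta f\<close>. Its vanishing makes
  the matrices of the two forms anticommute.\<close>

fun polar :: "'a::comm_ring_1 quadratic \<Rightarrow> 'a quadratic \<Rightarrow> 'a" where
  "polar (Quadratic a b c) (Quadratic a' b' c') = b * b' - 2 * a * c' - 2 * a' * c"

lemma polar_scale:
  "polar (map_quadratic ((*) c) f) (map_quadratic ((*) d) g) = c * d * polar f g"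
  by (cases f; cases g) (simp add: algebra_simps)

lemma polar_subst2:
  fixes f g :: "'a::idom quadratic"
  shows "polar (subst2 f p q r s) (subst2 g p q r s) = (p * s - q * r)^2 * polar f g"
  by (induction f; induction g) (simp, algebra)

lemma less_3_cases: "i < 3 \<longleftrightarrow> i = 0 \<or> i = 1 \<or> i = (2::nat)"
  by auto

text \<open>The points (X j, Y j) are zeros of one of the three forms and of no other, so evaluation
  at them tells the factors apart.\<close>

lemma significant_triple:
  assumes F: "biquadratic_equiv F"
  obtains \<phi> :: "nat \<Rightarrow> complex quadratic" and k :: complex and X Y :: "nat \<Rightarrow> complex"
  where "k \<noteq> 0"
    and "\<And>f. significant_factor F f \<longleftrightarrow> (\<exists>i<3. proportional f (\<phi> i))"
    and "\<And>x y. sextic_covariant F x y = k * (eval2 (\<phi> 0) x y * eval2 (\<phi> 1) x y * eval2 (\<phi> 2) x y)"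
    and "\<And>i j. i < 3 \<Longrightarrow> j < 3 \<Longrightarrow> eval2 (\<phi> i) (X j) (Y j) = 0 \<longleftrightarrow> i = j"
    and "\<And>i j. i < 3 \<Longrightarrow> j < 3 \<Longrightarrow> i \<noteq> j \<Longrightarrow> polar (\<phi> i) (\<phi> j) = 0"
proof -
  obtain m p q r s where m: "m^2 \<noteq> 4" and D: "p * s - q * r \<noteq> 0"
    and Feq: "F = subst4 (Quartic 1 0 m 0 1) p q r s"
    using F unfolding biquadratic_equiv_def by blast
  define D where "D = p * s - q * r"
  define \<psi> :: "nat \<Rightarrow> complex quadratic" where
    "\<psi> i = [Quadratic 0 1 0, Quadratic 1 0 (- 1), Quadratic 1 0 1] ! i" for i
  have \<psi>: "\<psi> 0 = Quadratic 0 1 0" "\<psi> 1 = Quadratic 1 0 (- 1)" "\<psi> (Suc 0) = Quadratic 1 0 (- 1)"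
    "\<psi> 2 = Quadratic 1 0 1"
    by (simp_all add: \<psi>_def)
  have sig: "significant_factor (Quartic 1 0 m 0 1) f \<longleftrightarrow> (\<exists>i<3. proportional f (\<psi> i))" for f
  proof -
    have "(\<exists>i<3. proportional f (\<psi> i))
        \<longleftrightarrow> proportional f (\<psi> 0) \<or> proportional f (\<psi> 1) \<or> proportional f (\<psi> 2)"
      unfolding less_3_cases by blast
    also have "\<dots> \<longleftrightarrow> (\<exists>c. c \<noteq> 0 \<and> (f = Quadratic 0 c 0 \<or> f = Quadratic c 0 (- c) \<or> f = Quadratic c 0 c))"
      unfolding proportional_def \<psi> by auto
    finally show ?thesis
      using significant_factor_biquadraticD[OF m, of f] significant_factor_biquadraticI[of _ m] by blast
  qed
  \<comment> \<open>The points (1, 0), (1, 1), (1, \<i>) are zeros of x y, x^2 - y^2, x^2 + y^2 in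
    this order.\<close>
  define x0 y0 :: "nat \<Rightarrow> complex" where "x0 i = 1" and "y0 i = [0, 1, \<i>] ! i" for i
  have pts: "eval2 (\<psi> i) (x0 j) (y0 j) = 0 \<longleftrightarrow> i = j" if "i < 3" "j < 3" for i j
    using that by (auto simp: less_3_cases x0_def y0_def \<psi>)
  have orth: "polar (\<psi> i) (\<psi> j) = 0" if "i < 3" "j < 3" "i \<noteq> j" for i j
    using that by (auto simp: less_3_cases \<psi>)
  define \<phi> where "\<phi> i = subst2 (\<psi> i) p q r s" for i
  show thesis
  proof (rule that)
    show "D^3 * (8 * (4 - m^2)) \<noteq> 0" using D m by (simp add: D_def)
    show "significant_factor F f \<longleftrightarrow> (\<exists>i<3. proportional f (\<phi> i))" for f
    proof -
      define g where "g = subst2 f (s / D) (- q / D) (- r / D) (p / D)"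
      have f: "f = subst2 g p q r s"
        using subst2_inverse(2)[OF D] unfolding g_def D_def by simp
      have "proportional f (\<phi> i) \<longleftrightarrow> proportional g (\<psi> i)" for i
        unfolding proportional_def f \<phi>_def subst2_scale[symmetric]
        using subst2_inverse(1)[OF D] by metis
      moreover have "significant_factor F f \<longleftrightarrow> significant_factor (Quartic 1 0 m 0 1) g"
        unfolding Feq f by (rule significant_factor_subst_iff[OF D])
      ultimately show ?thesis by (simp add: sig)
    qed
    show "sextic_covariant F x y
        = D^3 * (8 * (4 - m^2)) * (eval2 (\<phi> 0) x y * eval2 (\<phi> 1) x y * eval2 (\<phi> 2) x y)" for x y
    proof -
      have "X^5 * Y - X * Y^5 = X * Y * ((X^2 - Y^2) * (X^2 + Y^2))" for X Y :: complex
        by (simp add: algebra_simps eval_nat_numeral)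
      then show ?thesis
        unfolding Feq sextic_covariant_subst4 sextic_covariant_biquadratic \<phi>_def eval2_subst2
        by (simp add: \<psi> D_def)
    qed
    show "eval2 (\<phi> i) (s / D * x0 j + - q / D * y0 j) (- r / D * x0 j + p / D * y0 j) = 0 \<longleftrightarrow> i = j"
      if "i < 3" "j < 3" for i j
      using pts[OF that] subst2_inverse(1)[OF D, of "\<psi> i"]
      unfolding eval2_subst2[symmetric] \<phi>_def D_def by simp
    show "polar (\<phi> i) (\<phi> j) = 0" if "i < 3" "j < 3" "i \<noteq> j" for i j
      unfolding \<phi>_def polar_subst2 orth[OF that] by simp
  qed
qed

lemma significant_factor_polar:
  assumes F: "biquadratic_equiv F" and "significant_factor F f" "significant_factor F g"
    and "\<not> proportional f g"
  shows "polar f g = 0"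
proof -
  obtain \<phi> :: "nat \<Rightarrow> complex quadratic" and k X Y where
    sig: "\<And>f. significant_factor F f \<longleftrightarrow> (\<exists>i<3. proportional f (\<phi> i))" and
    orth: "\<And>i j. i < 3 \<Longrightarrow> j < 3 \<Longrightarrow> i \<noteq> j \<Longrightarrow> polar (\<phi> i) (\<phi> j) = 0"
    using significant_triple[OF F] by metis
  obtain i j where ij: "i < 3" "proportional f (\<phi> i)" "j < 3" "proportional g (\<phi> j)"
    using assms(2,3) sig by blast
  then have "i \<noteq> j" using assms(4) proportional_sym proportional_trans by blast
  then have "polar (\<phi> i) (\<phi> j) = 0" using orth ij by blast
  then show ?thesis
    using ij by (auto simp: proportional_def polar_scale)
qed

text \<open>Three pairwise non-proportional significant factors belong to three different indices
  below 3, hence to all of them.\<close>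

lemma significant_factors_exhaust:
  assumes F: "biquadratic_equiv F"
    and "significant_factor F f1" "significant_factor F f2" "significant_factor F f3"
    and "\<not> proportional f1 f2" "\<not> proportional f1 f3" "\<not> proportional f2 f3"
  shows "\<And>g. significant_factor F g \<Longrightarrow> proportional g f1 \<or> proportional g f2 \<or> proportional g f3"
    and "\<exists>k. k \<noteq> 0 \<and> (\<forall>x y. sextic_covariant F x y = k * (eval2 f1 x y * eval2 f2 x y * eval2 f3 x y))"
proof -
  obtain \<phi> :: "nat \<Rightarrow> complex quadratic" and k where
    k: "k \<noteq> 0" and
    sig: "\<And>f. significant_factor F f \<longleftrightarrow> (\<exists>i<3. proportional f (\<phi> i))" and
    prod: "\<And>x y. sextic_covariant F x y = k * (eval2 (\<phi> 0) x y * eval2 (\<phi> 1) x y * eval2 (\<phi> 2) x y)"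
    using significant_triple[OF F] by metis
  obtain i1 i2 i3 where i: "i1 < 3" "proportional f1 (\<phi> i1)" "i2 < 3" "proportional f2 (\<phi> i2)"
    "i3 < 3" "proportional f3 (\<phi> i3)"
    using assms(2-4) sig by blast
  have ne: "i1 \<noteq> i2" "i1 \<noteq> i3" "i2 \<noteq> i3"
    using i assms(5-) proportional_sym proportional_trans by blast+
  show "proportional g f1 \<or> proportional g f2 \<or> proportional g f3" if g: "significant_factor F g" for g
  proof -
    obtain j where j: "j < 3" "proportional g (\<phi> j)" using sig g by blast
    then have "j = i1 \<or> j = i2 \<or> j = i3" using i(1,3,5) ne by (simp add: less_3_cases) metis
    then show ?thesis using i j proportional_sym proportional_trans by blast
  qed
  obtain c1 c2 c3 where c: "c1 \<noteq> 0" "f1 = map_quadratic ((*) c1) (\<phi> i1)"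
    "c2 \<noteq> 0" "f2 = map_quadratic ((*) c2) (\<phi> i2)" "c3 \<noteq> 0" "f3 = map_quadratic ((*) c3) (\<phi> i3)"
    using i unfolding proportional_def by blast
  have "eval2 (\<phi> i1) x y * eval2 (\<phi> i2) x y * eval2 (\<phi> i3) x y
      = eval2 (\<phi> 0) x y * eval2 (\<phi> 1) x y * eval2 (\<phi> 2) x y" for x y
    using i(1,3,5) ne unfolding less_3_cases by (elim disjE) (simp_all add: mult_ac)
  then have "sextic_covariant F x y
      = k / (c1 * c2 * c3) * (eval2 f1 x y * eval2 f2 x y * eval2 f3 x y)" for x y
    unfolding prod c(2,4,6) eval2_scale using c(1,3,5) by (simp add: field_simps)
  moreover have "k / (c1 * c2 * c3) \<noteq> 0" using k c by simp
  ultimately show "\<exists>k. k \<noteq> 0 \<and>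
      (\<forall>x y. sextic_covariant F x y = k * (eval2 f1 x y * eval2 f2 x y * eval2 f3 x y))"
    by blast
qed

text \<open>The sextic vanishes at all three separating points, each factor at exactly one of them,
  so different factors must own different points.\<close>

lemma significant_factorization_distinct:
  assumes F: "biquadratic_equiv F"
    and "significant_factor F f1" "significant_factor F f2" "significant_factor F f3"
    and prod: "\<And>x y. sextic_covariant F x y = eval2 f1 x y * eval2 f2 x y * eval2 f3 x y"
  shows "\<not> proportional f1 f2" "\<not> proportional f1 f3" "\<not> proportional f2 f3"
proof -
  obtain \<phi> :: "nat \<Rightarrow> complex quadratic" and k :: complex and X Y :: "nat \<Rightarrow> complex" where
    sig: "\<And>f. significant_factor F f \<longleftrightarrow> (\<exists>i<3. proportional f (\<phi> i))" and
    prod': "\<And>x y. sextic_covariant F x y = k * (eval2 (\<phi> 0) x y * eval2 (\<phi> 1) x y * eval2 (\<phi> 2) x y)" and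
    pts: "\<And>i j. i < 3 \<Longrightarrow> j < 3 \<Longrightarrow> eval2 (\<phi> i) (X j) (Y j) = 0 \<longleftrightarrow> i = j"
    using significant_triple[OF F] by metis
  have ex: "\<exists>i. i < 3 \<and> (\<forall>j<3. eval2 f (X j) (Y j) = 0 \<longleftrightarrow> i = j)" if "significant_factor F f" for f
  proof -
    obtain i c where "i < 3" "c \<noteq> 0" "f = map_quadratic ((*) c) (\<phi> i)"
      using \<open>significant_factor F f\<close> sig unfolding proportional_def by blast
    then show ?thesis using pts by (intro exI[of _ i]) (simp add: eval2_scale)
  qed
  obtain i1 where i1: "i1 < 3" "\<And>j. j < 3 \<Longrightarrow> eval2 f1 (X j) (Y j) = 0 \<longleftrightarrow> i1 = j"
    using ex[OF assms(2)] by blast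
  obtain i2 where i2: "i2 < 3" "\<And>j. j < 3 \<Longrightarrow> eval2 f2 (X j) (Y j) = 0 \<longleftrightarrow> i2 = j"
    using ex[OF assms(3)] by blast
  obtain i3 where i3: "i3 < 3" "\<And>j. j < 3 \<Longrightarrow> eval2 f3 (X j) (Y j) = 0 \<longleftrightarrow> i3 = j"
    using ex[OF assms(4)] by blast
  have "sextic_covariant F (X j) (Y j) = 0" if "j < 3" for j
    using that pts[of j j] unfolding prod' by (auto simp: less_3_cases)
  then have cover: "i1 = j \<or> i2 = j \<or> i3 = j" if "j < 3" for j
    using that i1(2) i2(2) i3(2) unfolding prod by auto
  have ne: "i1 \<noteq> i2" "i1 \<noteq> i3" "i2 \<noteq> i3"
    using cover[of 0] cover[of 1] cover[of 2] by auto
  have same: "i = i'"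
    if fg: "proportional f g" and i': "i' < 3"
      and f: "\<And>j. j < 3 \<Longrightarrow> eval2 f (X j) (Y j) = 0 \<longleftrightarrow> i = j"
      and g: "\<And>j. j < 3 \<Longrightarrow> eval2 g (X j) (Y j) = 0 \<longleftrightarrow> i' = j" for f g :: "complex quadratic" and i i'
    using fg f[OF i'] g[OF i'] by (auto simp: proportional_def eval2_scale)
  show "\<not> proportional f1 f2" "\<not> proportional f1 f3" "\<not> proportional f2 f3"
    using same[OF _ i2(1) i1(2) i2(2)] same[OF _ i3(1) i1(2) i3(2)] same[OF _ i3(1) i2(2) i3(2)] ne
    by blast+
qed

section \<open>The matrices of real quadratic forms\<close>

definition mat2 :: "real \<Rightarrow> real \<Rightarrow> real \<Rightarrow> real \<Rightarrow> real^2^2" where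
  "mat2 a b c d = vector [vector [a, b], vector [c, d]]"

lemma mat2_nth [simp]:
  "mat2 a b c d $ 1 $ 1 = a" "mat2 a b c d $ 1 $ 2 = b"
  "mat2 a b c d $ 2 $ 1 = c" "mat2 a b c d $ 2 $ 2 = d"
  by (simp_all add: mat2_def)

lemma mat2_cases: obtains a b c d where "T = mat2 a b c d"
  by (rule that[of "T $ 1 $ 1" "T $ 1 $ 2" "T $ 2 $ 1" "T $ 2 $ 2"])
    (simp add: vec_eq_iff forall_2)

lemma mat2_eq_iff [simp]:
  "mat2 a b c d = mat2 a' b' c' d' \<longleftrightarrow> a = a' \<and> b = b' \<and> c = c' \<and> d = d'"
  by (auto simp: vec_eq_iff forall_2)

lemma mat2_mult:
  "mat2 a b c d ** mat2 a' b' c' d'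
     = mat2 (a * a' + b * c') (a * b' + b * d') (c * a' + d * c') (c * b' + d * d')"
  by (simp add: vec_eq_iff forall_2 matrix_matrix_mult_def sum_2)

lemma uminus_mat2: "- mat2 a b c d = mat2 (- a) (- b) (- c) (- d)"
  by (simp add: vec_eq_iff forall_2)

lemma mat_1_eq_mat2: "mat 1 = mat2 1 0 0 1"
  by (simp add: vec_eq_iff forall_2 mat_def)

lemma det_mat2: "det (mat2 a b c d) = a * d - b * c"
  by (simp add: det_2)

lemma U_mat_eq_mat2:
  "U_mat (Quadratic a b c) =
     mat2 (b / sqrt \<bar>Delta (Quadratic a b c)\<bar>) (2 * c / sqrt \<bar>Delta (Quadratic a b c)\<bar>)
       (- 2 * a / sqrt \<bar>Delta (Quadratic a b c)\<bar>) (- b / sqrt \<bar>Delta (Quadratic a b c)\<bar>)"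
  by (simp add: vec_eq_iff forall_2)

lemma Delta_scale: "Delta (map_quadratic ((*) c) f) = c^2 * Delta f"
  by (cases f) (simp add: algebra_simps power2_eq_square)

lemma U_mat_scale:
  assumes "c \<noteq> 0"
  shows "U_mat (map_quadratic ((*) c) f) = sgn c *\<^sub>R U_mat f"
proof -
  obtain x y z where f: "f = Quadratic x y z" by (cases f)
  have "sqrt \<bar>Delta (map_quadratic ((*) c) f)\<bar> = \<bar>c\<bar> * sqrt \<bar>Delta f\<bar>"
    by (simp add: Delta_scale abs_mult real_sqrt_mult)
  moreover have "c * t / (\<bar>c\<bar> * s) = sgn c * (t / s)" for t s
    using assms by (simp add: sgn_if)
  ultimately show ?thesis
    unfolding f by (simp add: vec_eq_iff forall_2 del: Delta.simps)
      (metis mult.left_commute mult_minus_right)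
qed

lemma U_mat_proportional:
  assumes "proportional f g"
  shows "U_mat f = U_mat g \<or> U_mat f = - U_mat g"
proof -
  obtain c where "c \<noteq> 0" "f = map_quadratic ((*) c) g"
    using assms unfolding proportional_def by blast
  then show ?thesis using U_mat_scale[of c g] by (cases "c > 0") (simp_all add: sgn_if)
qed

lemma proportional_if_U_mat_eq:
  assumes "Delta f \<noteq> 0" "Delta g \<noteq> 0" and U: "U_mat f = U_mat g \<or> U_mat f = - U_mat g"
  shows "proportional f g"
proof -
  obtain a b c a' b' c' where fg: "f = Quadratic a b c" "g = Quadratic a' b' c'"
    by (cases f, cases g)
  define s s' where "s = sqrt \<bar>Delta f\<bar>" and "s' = sqrt \<bar>Delta g\<bar>"
  have s: "s > 0" "s' > 0" using assms by (simp_all add: s_def s'_def)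
  obtain \<epsilon> :: real where "\<epsilon> = 1 \<or> \<epsilon> = - 1" and
    eq: "b / s = \<epsilon> * (b' / s')" "2 * c / s = \<epsilon> * (2 * c' / s')" "- 2 * a / s = \<epsilon> * (- 2 * a' / s')"
    using U unfolding fg U_mat_eq_mat2 uminus_mat2 s_def s'_def
    by (metis (no_types, lifting) mat2_eq_iff mult_1 mult_minus1)
  then have "\<epsilon> * s / s' \<noteq> 0" using s by auto
  moreover have "a = \<epsilon> * s / s' * a'" "b = \<epsilon> * s / s' * b'" "c = \<epsilon> * s / s' * c'"
    using eq s by (simp_all add: field_simps)
  ultimately show ?thesis
    unfolding proportional_def fg by (metis quadratic.map)
qed

text \<open>The unnormalised matrix squares to \<open>Delta f\<close> times the identity. Indefinite
  forms thus give involutions, definite forms elements of order four.\<close>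

lemma U_mat_square:
  assumes "Delta f \<noteq> 0"
  shows "U_mat f ** U_mat f = (if Delta f > 0 then mat 1 else - mat 1)"
proof -
  obtain a b c where f: "f = Quadratic a b c" by (cases f)
  define s where "s = sqrt \<bar>Delta f\<bar>"
  have s: "s > 0" "s^2 = \<bar>Delta f\<bar>" using assms by (simp_all add: s_def)
  have "(b / s) * (b / s) + (2 * c / s) * (- 2 * a / s) = Delta f / s^2"
    by (simp add: f power2_eq_square diff_divide_distrib)
  also have "\<dots> = (if Delta f > 0 then 1 else - 1)" using s assms by auto
  finally show ?thesis
    unfolding f U_mat_eq_mat2 mat2_mult unfolding f[symmetric] s_def[symmetric]
    by (simp add: mat_1_eq_mat2 uminus_mat2 mult.commute)
qed

text \<open>The diagonal entries of \<open>U_mat f\<close> are opposite, those of \<plusminus>1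
  equal and non-zero.\<close>

lemma U_mat_neq_scalar:
  assumes "Delta f \<noteq> 0"
  shows "U_mat f \<noteq> mat 1" "U_mat f \<noteq> - mat 1"
  by (cases f; auto simp only: U_mat_eq_mat2 mat_1_eq_mat2 uminus_mat2 mat2_eq_iff)+

text \<open>For 2 by 2 matrices of trace zero, X Y + Y X is the trace of X Y times the identity; for
  the unnormalised matrices this trace is 2 \<open>polar f g\<close>.\<close>

lemma U_mat_anticommute:
  assumes "polar f g = 0"
  shows "U_mat f ** U_mat g = - (U_mat g ** U_mat f)"
proof -
  obtain a b c a' b' c' where fg: "f = Quadratic a b c" "g = Quadratic a' b' c'"
    by (cases f, cases g)
  have "b * b' = 2 * a * c' + 2 * a' * c" using assms by (simp add: fg)
  then have "(b * b') / (s * s') = (2 * a * c' + 2 * a' * c) / (s * s')" for s s' :: real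
    by simp
  then show ?thesis
    unfolding fg U_mat_eq_mat2 mat2_mult uminus_mat2
    by (simp add: add_divide_distrib mult_ac del: Delta.simps)
qed

text \<open>\<open>Delta\<close> has signature (2, 1) and definite forms are its negative vectors,
  no two of which are orthogonal. Concretely, (b b')^2 < 16 a c a' c' \<le> 4 (a c' + a' c)^2, the
  second step being the inequality of arithmetic and geometric means.\<close>

lemma polar_neq_0_if_definite:
  fixes f g :: "real quadratic"
  assumes "Delta f < 0" "Delta g < 0"
  shows "polar f g \<noteq> 0"
proof -
  obtain a b c a' b' c' where fg: "f = Quadratic a b c" "g = Quadratic a' b' c'"
    by (cases f, cases g)
  have 1: "b^2 < 4 * (a * c)" "b'^2 < 4 * (a' * c')" using assms by (simp_all add: fg)
  then have pos: "0 < a * c" "0 < a' * c'"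
    using zero_le_power2[of b] zero_le_power2[of b'] by linarith+
  have "b^2 * b'^2 < (4 * (a * c)) * (4 * (a' * c'))"
    using 1 pos by (intro mult_strict_mono) simp_all
  then have "(b * b')^2 < 16 * ((a * c') * (a' * c))"
    by (simp add: power_mult_distrib mult_ac)
  moreover have "4 * (4 * ((a * c') * (a' * c))) \<le> 4 * (a * c' + a' * c)^2"
    using zero_le_power2[of "a * c' - a' * c"] by (simp add: power2_eq_square algebra_simps)
  moreover have "(2 * a * c' + 2 * a' * c)^2 = 4 * (a * c' + a' * c)^2"
    by (simp add: power2_eq_square algebra_simps)
  ultimately have "(b * b')^2 < (2 * a * c' + 2 * a' * c)^2" by linarith
  then have "b * b' \<noteq> 2 * a * c' + 2 * a' * c" by auto
  then show ?thesis by (simp add: fg)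
qed

section \<open>Real forms inside the complex ones, and rationality\<close>

lemma map_quadratic_of_real_scale:
  assumes eq: "map_quadratic complex_of_real f = map_quadratic ((*) c) (map_quadratic complex_of_real g)"
    and "Delta g \<noteq> 0"
  shows "f = map_quadratic ((*) (Re c)) g" "c = complex_of_real (Re c)"
proof -
  obtain a b d a' b' d' where fg: "f = Quadratic a b d" "g = Quadratic a' b' d'"
    by (cases f, cases g)
  have e: "of_real a = c * of_real a'" "of_real b = c * of_real b'" "of_real d = c * of_real d'"
    using eq by (simp_all add: fg)
  \<comment> \<open>A non-zero real coefficient of g forces the scalar c to be real.\<close>
  have "a' \<noteq> 0 \<or> b' \<noteq> 0" using assms(2) by (auto simp: fg)
  then have "Im c = 0" using e(1,2) by (auto simp: complex_eq_iff)
  then show "c = complex_of_real (Re c)" by (simp add: complex_eq_iff)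
  show "f = map_quadratic ((*) (Re c)) g"
    using e by (simp add: fg complex_eq_iff)
qed

lemma proportional_of_real:
  assumes "Delta g \<noteq> 0"
  shows "proportional (map_quadratic complex_of_real f) (map_quadratic complex_of_real g)
    \<longleftrightarrow> proportional f g"
proof
  assume "proportional (map_quadratic complex_of_real f) (map_quadratic complex_of_real g)"
  then obtain c where "c \<noteq> 0"
    and eq: "map_quadratic complex_of_real f = map_quadratic ((*) c) (map_quadratic complex_of_real g)"
    unfolding proportional_def by blast
  then show "proportional f g"
    using map_quadratic_of_real_scale[OF eq assms] unfolding proportional_def
    by (metis of_real_0)
next
  assume "proportional f g"
  then obtain c where "c \<noteq> 0" "f = map_quadratic ((*) c) g"
    unfolding proportional_def by blast
  then show "proportional (map_quadratic complex_of_real f) (map_quadratic complex_of_real g)"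
    unfolding proportional_def by (intro exI[of _ "complex_of_real c"]) (cases g, simp)
qed

lemma Delta_of_real: "Delta (map_quadratic of_real f) = (of_real (Delta f) :: complex)"
  by (cases f) simp

lemma Delta_of_int: "Delta (map_quadratic of_int f) = (of_int (Delta f) :: 'a::comm_ring_1)"
  by (cases f) simp

lemma polar_of_real: "polar (map_quadratic of_real f) (map_quadratic of_real g) = complex_of_real (polar f g)"
  by (cases f; cases g) simp

text \<open>For a proportional integer form with square \<bar>Delta\<bar> the normalising root is an
  integer. Conversely, clearing the denominators of \<open>U_mat f\<close> produces such a
  form.\<close>

lemma rationally_good_iff:
  assumes "Delta f \<noteq> 0"
  shows "rationally_good (map_quadratic complex_of_real f) \<longleftrightarrow> (\<forall>i j. U_mat f $ i $ j \<in> \<rat>)"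
proof
  assume "rationally_good (map_quadratic complex_of_real f)"
  then obtain g k c where c: "c \<noteq> 0"
    and eq: "map_quadratic complex_of_real f = map_quadratic ((*) c) (map_quadratic of_int g)"
    and k: "\<bar>Delta g\<bar> = k^2"
    unfolding rationally_good_def proportional_def by blast
  define h :: "real quadratic" where "h = map_quadratic of_int g"
  have gh: "map_quadratic of_int g = map_quadratic complex_of_real h"
    unfolding h_def by (cases g) simp
  have "complex_of_real (Delta f) = c^2 * of_int (Delta g)"
    using arg_cong[OF eq, of Delta]
    unfolding Delta_of_real Delta_of_int Delta_scale .
  then have "Delta g \<noteq> 0" using assms by auto
  then have h0: "Delta h \<noteq> 0" by (simp add: h_def Delta_of_int)
  have f: "f = map_quadratic ((*) (Re c)) h" "c = complex_of_real (Re c)"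
    using map_quadratic_of_real_scale[OF _ h0] eq unfolding gh by blast+
  then have "proportional f h" using c unfolding proportional_def by (metis of_real_0)
  then have "U_mat f = U_mat h \<or> U_mat f = - U_mat h" by (rule U_mat_proportional)
  moreover have "U_mat h $ i $ j \<in> \<rat>" for i j
  proof -
    have "\<bar>Delta h\<bar> = of_int (\<bar>Delta g\<bar>)" by (simp add: h_def Delta_of_int)
    then have s: "sqrt \<bar>Delta h\<bar> = of_int \<bar>k\<bar>" by (simp add: k)
    obtain x y z where g: "g = Quadratic x y z" by (cases g)
    have "\<forall>i j. U_mat h $ i $ j \<in> \<rat>"
      using s unfolding h_def g quadratic.map U_mat_eq_mat2
      by (simp add: forall_2 del: Delta.simps)
    then show ?thesis by blast
  qed
  ultimately show "\<forall>i j. U_mat f $ i $ j \<in> \<rat>" by auto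
next
  assume rat: "\<forall>i j. U_mat f $ i $ j \<in> \<rat>"
  obtain a b c where f: "f = Quadratic a b c" by (cases f)
  define s where "s = sqrt \<bar>Delta f\<bar>"
  have s: "s > 0" "s^2 = \<bar>Delta f\<bar>" using assms by (simp_all add: s_def)
  have "b / s \<in> \<rat>" "2 * c / s \<in> \<rat>" "- 2 * a / s \<in> \<rat>"
    using rat unfolding f U_mat_eq_mat2 unfolding f[symmetric] s_def[symmetric]
    by (simp_all add: forall_2)
  then obtain x1 y1 x2 y2 x3 y3 :: int where xy: "y1 > 0" "b / s = of_int x1 / of_int y1"
    "y2 > 0" "2 * c / s = of_int x2 / of_int y2" "y3 > 0" "- 2 * a / s = of_int x3 / of_int y3"
    by (meson Rats_cases')
  \<comment> \<open>A common denominator of b/s, 2c/s and -2a/s, doubled to undo the 2 in the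
    off-diagonal entries. The form g below is (n/s) f, so \<bar>Delta g\<bar> = n^2.\<close>
  define n where "n = 2 * y1 * y2 * y3"
  have n: "n > 0" using xy by (simp add: n_def)
  define g where "g = Quadratic (- x3 * y1 * y2) (2 * x1 * y2 * y3) (x2 * y1 * y3)"
  have *: "a = s / of_int n * of_int (- x3 * y1 * y2)" "b = s / of_int n * of_int (2 * x1 * y2 * y3)"
    "c = s / of_int n * of_int (x2 * y1 * y3)"
    using xy s by (simp_all add: n_def field_simps)
  then have fg: "f = map_quadratic ((*) (s / of_int n)) (map_quadratic of_int g)"
    by (simp add: f g_def)
  have "Delta f = (s / of_int n)^2 * of_int (Delta g)"
    unfolding fg Delta_scale Delta_of_int ..
  from arg_cong[OF this, of abs] have "\<bar>Delta f\<bar> = \<bar>Delta f\<bar> / (of_int n)^2 * of_int \<bar>Delta g\<bar>"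
    by (simp add: abs_mult power_divide s(2))
  then have "of_int \<bar>Delta g\<bar> = (of_int (n^2) :: real)"
    using n assms by (simp add: field_simps)
  then have "\<bar>Delta g\<bar> = n^2" by (simp only: of_int_eq_iff)
  moreover have "proportional (map_quadratic complex_of_real f) (map_quadratic of_int g)"
    unfolding proportional_def
    by (rule exI[of _ "complex_of_real (s / of_int n)"], subst fg) (use s n in \<open>cases g, simp\<close>)
  ultimately show "rationally_good (map_quadratic complex_of_real f)"
    unfolding rationally_good_def by blast
qed

section \<open>The automorphism group\<close>

lemma mult_GL2Q [simp]: "mult GL2Q = (**)" and one_GL2Q [simp]: "one GL2Q = mat 1"
  by (simp_all add: GL2Q_def)

lemma mult_Aut [simp]: "mult (Aut F) = (**)" and one_Aut [simp]: "one (Aut F) = mat 1"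
  by (simp_all add: Aut_def)

lemma mat2_in_GL2Q:
  "mat2 t u v w \<in> carrier GL2Q \<longleftrightarrow> t * w - u * v \<noteq> 0 \<and> t \<in> \<rat> \<and> u \<in> \<rat> \<and> v \<in> \<rat> \<and> w \<in> \<rat>"
  by (simp add: GL2Q_def invertible_det_nz det_mat2 forall_2)

lemma group_GL2Q: "group GL2Q"
proof (rule groupI)
  fix S T assume "S \<in> carrier GL2Q" "T \<in> carrier GL2Q"
  then have "invertible (S ** T)" "\<forall>i j. (S ** T) $ i $ j \<in> \<rat>"
    by (simp_all add: GL2Q_def invertible_mult) (simp add: matrix_matrix_mult_def sum_2)
  then show "S \<otimes>\<^bsub>GL2Q\<^esub> T \<in> carrier GL2Q"
    by (simp add: GL2Q_def)
next
  show "\<one>\<^bsub>GL2Q\<^esub> \<in> carrier GL2Q" by (simp add: mat_1_eq_mat2 mat2_in_GL2Q)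
next
  fix S assume S: "S \<in> carrier GL2Q"
  obtain t u v w where Seq: "S = mat2 t u v w" by (rule mat2_cases)
  define d where "d = t * w - u * v"
  have d: "d \<noteq> 0" "t \<in> \<rat>" "u \<in> \<rat>" "v \<in> \<rat>" "w \<in> \<rat>"
    using S by (simp_all add: Seq mat2_in_GL2Q d_def)
  then have "d \<in> \<rat>" by (simp add: d_def)
  have "w / d * (t / d) - - u / d * (- v / d) = d / (d * d)"
    by (simp add: d_def diff_divide_distrib mult.commute)
  then have "mat2 (w / d) (- u / d) (- v / d) (t / d) \<in> carrier GL2Q"
    unfolding mat2_in_GL2Q using d \<open>d \<in> \<rat>\<close> by simp
  moreover have "mat2 (w / d) (- u / d) (- v / d) (t / d) ** S = mat 1"
    unfolding Seq mat2_mult mat_1_eq_mat2 mat2_eq_iff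
    using inverse_entries(5-8)[of t w u v] d(1) unfolding d_def by blast
  ultimately show "\<exists>T\<in>carrier GL2Q. T \<otimes>\<^bsub>GL2Q\<^esub> S = \<one>\<^bsub>GL2Q\<^esub>" by auto
qed (simp_all add: matrix_mul_assoc)

lemma matrix_mult_uminus:
  fixes S T :: "real^2^2"
  shows "(- S) ** T = - (S ** T)" "S ** (- T) = - (S ** T)"
  by (simp_all add: vec_eq_iff forall_2 matrix_matrix_mult_def sum_2)

text \<open>Since U^2 is 1 or -1, the four matrices are closed under products and inverses.\<close>

lemma generate_square_root:
  assumes U: "U \<in> carrier GL2Q" and U2: "U ** U = mat 1 \<or> U ** U = - mat 1"
  shows "generate GL2Q {U, - mat 1} = {mat 1, - mat 1, U, - U}"
proof -
  interpret group GL2Q by (rule group_GL2Q)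
  have m: "- mat 1 \<in> carrier GL2Q" by (simp add: mat_1_eq_mat2 uminus_mat2 mat2_in_GL2Q)
  have mU: "- U \<in> carrier GL2Q" using m_closed[OF m U] by (simp add: matrix_mult_uminus)
  have inv1: "inv\<^bsub>GL2Q\<^esub> (- mat 1) = - mat 1"
    by (rule inv_equality) (simp_all add: m matrix_mult_uminus)
  have invU: "inv\<^bsub>GL2Q\<^esub> U \<in> {U, - U}"
    using U2
  proof
    assume "U ** U = mat 1"
    then have "inv\<^bsub>GL2Q\<^esub> U = U" by (intro inv_equality) (simp_all add: U)
    then show ?thesis by simp
  next
    assume "U ** U = - mat 1"
    then have "inv\<^bsub>GL2Q\<^esub> U = - U" by (intro inv_equality) (simp_all add: U mU matrix_mult_uminus)
    then show ?thesis by simp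
  qed
  have "T \<in> {mat 1, - mat 1, U, - U}" if "T \<in> generate GL2Q {U, - mat 1}" for T
    using that
  proof (induction rule: generate.induct)
    case (eng S T)
    then show ?case using U2 by (auto simp: matrix_mult_uminus)
  qed (use inv1 invU in auto)
  moreover have "- U \<in> generate GL2Q {U, - mat 1}"
    using generate.eng[of "- mat 1" GL2Q "{U, - mat 1}" U] generate.incl[of _ "{U, - mat 1}" GL2Q]
    by (simp add: matrix_mult_uminus)
  ultimately show ?thesis
    using generate.one[of GL2Q "{U, - mat 1}"] generate.incl[of _ "{U, - mat 1}" GL2Q] by auto
qed

section \<open>Automorphisms of integer quartics\<close>

lemma map_quartic_of_int_complex:
  "map_quartic of_int F = map_quartic complex_of_real (map_quartic of_int F)"
  by (cases F) simp

lemma eval4_of_real: "eval4 (map_quartic of_real F) (of_real x) (of_real y) = complex_of_real (eval4 F x y)"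
  by (cases F) simp

lemma sextic_covariant_of_real:
  "sextic_covariant (map_quartic of_real F) (of_real x) (of_real y) = complex_of_real (sextic_covariant F x y)"
  by (cases F) simp

lemma eval2_of_real: "eval2 (map_quadratic of_real f) (of_real x) (of_real y) = complex_of_real (eval2 f x y)"
  by (cases f) simp

lemma subst4_of_real:
  "subst4 (map_quartic of_real F) (of_real p) (of_real q) (of_real r) (of_real s)
     = map_quartic complex_of_real (subst4 F p q r s)"
  by (cases F) simp

lemma disc4_of_int: "disc4 (map_quartic of_int F) = of_int (disc4 F)"
  by (cases F) simp

text \<open>Reality matters: over the complex numbers diag(1, \<i>) fixes x^4 + y^4 and has squared
  determinant -1. Here \<open>D\<close> is non-negative, so D^2 = 1 or D^3 = 1 yields D = 1; a
  non-zero \<open>I_inv\<close> gives the former, a non-zero \<open>J_inv\<close> the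
  latter.\<close>

lemma subst4_fixed_det:
  fixes F :: "real quartic"
  assumes "disc4 F \<noteq> 0" and inv: "subst4 F p q r s = F"
  shows "(p * s - q * r)^2 = 1"
proof -
  define D where "D = (p * s - q * r)^2"
  have D: "D \<ge> 0" by (simp add: D_def)
  have "I_inv F \<noteq> 0 \<or> J_inv F \<noteq> 0"
    using assms(1) disc4_eq_invs[of F] by auto
  moreover have "D^2 * I_inv F = I_inv F" "D^3 * J_inv F = J_inv F"
    using I_inv_subst4[of F p q r s] J_inv_subst4[of F p q r s] unfolding inv D_def
    by (simp_all flip: power_mult)
  ultimately have "D^2 = 1^2 \<or> D^3 = 1^3" by auto
  then show ?thesis
    using power_eq_imp_eq_base[of D _ 1] D unfolding D_def[symmetric]
    by (metis zero_le_one zero_less_numeral)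
qed

text \<open>Fixing the form forces the squared determinant to be 1, which supplies the invertibility
  contained in \<open>GL2Q\<close>.\<close>

lemma carrier_Aut_iff:
  fixes F :: "int quartic"
  assumes "disc4 F \<noteq> 0"
  shows "mat2 t u v w \<in> carrier (Aut F) \<longleftrightarrow>
    t \<in> \<rat> \<and> u \<in> \<rat> \<and> v \<in> \<rat> \<and> w \<in> \<rat> \<and>
    subst4 (map_quartic real_of_int F) t u v w = map_quartic real_of_int F"
proof -
  have d: "disc4 (map_quartic real_of_int F) \<noteq> 0" using assms by (simp add: disc4_of_int)
  have "subst_form (eval4 (map_quartic real_of_int F)) (mat2 t u v w) = eval4 (map_quartic real_of_int F)
      \<longleftrightarrow> (\<forall>x y. eval4 (subst4 (map_quartic real_of_int F) t u v w) x y = eval4 (map_quartic real_of_int F) x y)"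
    by (simp add: fun_eq_iff subst_form_def eval4_subst4)
  also have "\<dots> \<longleftrightarrow> subst4 (map_quartic real_of_int F) t u v w = map_quartic real_of_int F"
    using eval4_inject by metis
  finally show ?thesis
    using subst4_fixed_det[OF d, of t u v w] unfolding Aut_def by (auto simp: mat2_in_GL2Q)
qed

lemma biquadratic_equiv_of_int:
  assumes "disc4 F \<noteq> 0"
  shows "biquadratic_equiv (map_quartic of_int F)"
  by (rule biquadratic_equiv_disc4) (simp add: disc4_of_int assms)

lemma real_good_factor_Delta:
  assumes "disc4 F \<noteq> 0" "real_good_factor F f"
  shows "Delta f \<noteq> 0"
proof -
  obtain a b c where f: "map_quadratic complex_of_real f = Quadratic a b c"
    using quadratic.exhaust by blast
  have "complex_of_real (Delta f) \<noteq> 0"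
    using significant_factor_automorphism(1)[OF biquadratic_equiv_of_int[OF assms(1)]] assms(2)
    unfolding real_good_factor_def Delta_of_real[symmetric] f by blast
  then show ?thesis by simp
qed

lemma real_good_factor_proportional:
  assumes "disc4 F \<noteq> 0" "real_good_factor F f" "proportional g f"
  shows "real_good_factor F g"
proof -
  have f: "Delta f \<noteq> 0" using real_good_factor_Delta assms by blast
  obtain c where "c \<noteq> 0" "g = map_quadratic ((*) c) f"
    using assms(3) unfolding proportional_def by blast
  then have g: "Delta g \<noteq> 0" using f by (simp add: Delta_scale)
  have "\<forall>i j. U_mat g $ i $ j \<in> \<rat>"
    using U_mat_proportional[OF assms(3)] assms(2) rationally_good_iff[OF f]
    unfolding real_good_factor_def by auto
  moreover have "proportional (map_quadratic complex_of_real g) (map_quadratic complex_of_real f)"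
    using assms(3) proportional_of_real[OF f] by blast
  ultimately show ?thesis
    using assms(2) significant_factor_proportional rationally_good_iff[OF g]
    unfolding real_good_factor_def by blast
qed

lemma carrier_Aut:
  assumes F: "disc4 F \<noteq> 0"
  shows "T \<in> carrier (Aut F) \<longleftrightarrow>
    T = mat 1 \<or> T = - mat 1 \<or> (\<exists>f. real_good_factor F f \<and> (T = U_mat f \<or> T = - U_mat f))"
proof -
  define R where "R = map_quartic real_of_int F"
  have C: "map_quartic complex_of_int F = map_quartic of_real R"
    unfolding R_def by (rule map_quartic_of_int_complex)
  have bi: "biquadratic_equiv (map_quartic of_real R)"
    using biquadratic_equiv_of_int[OF F] unfolding C .
  have dR: "disc4 R \<noteq> 0" using F by (simp add: R_def disc4_of_int)
  have neg: "- T \<in> carrier (Aut F)" if T: "T \<in> carrier (Aut F)" for T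
  proof -
    obtain t u v w where Teq: "T = mat2 t u v w" by (rule mat2_cases)
    have "subst4 G (- t) (- u) (- v) (- w) = subst4 G t u v w" for G :: "real quartic"
      by (cases G) simp
    then show ?thesis using T unfolding Teq uminus_mat2 carrier_Aut_iff[OF F] by simp
  qed
  have one: "mat 1 \<in> carrier (Aut F)"
    unfolding mat_1_eq_mat2 carrier_Aut_iff[OF F] by (simp add: subst4_id)
  have good: "U_mat f \<in> carrier (Aut F)" if f: "real_good_factor F f" for f
  proof -
    obtain a b c where feq: "f = Quadratic a b c" by (cases f)
    have \<Delta>: "Delta f \<noteq> 0" using real_good_factor_Delta F f by blast
    define s where "s = sqrt \<bar>Delta f\<bar>"
    have s: "s > 0" "s^2 = \<bar>Delta f\<bar>" using \<Delta> by (simp_all add: s_def)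
    have "s^4 = (s^2)^2" by (simp flip: power_mult)
    then have s4: "s^4 = (Delta f)^2" unfolding s(2) by simp
    have "significant_factor (map_quartic of_real R)
        (Quadratic (complex_of_real a) (complex_of_real b) (complex_of_real c))"
      using f unfolding real_good_factor_def C feq by simp
    note aut = significant_factor_automorphism(2)[OF bi this]
    have eval: "eval4 R (b * x + 2 * c * y) (- 2 * a * x - b * y) = (Delta f)^2 * eval4 R x y" for x y
    proof -
      have "complex_of_real b * of_real x + 2 * of_real c * of_real y = of_real (b * x + 2 * c * y)"
        "- 2 * complex_of_real a * of_real x - of_real b * of_real y = of_real (- 2 * a * x - b * y)"
        "Delta (Quadratic (complex_of_real a) (of_real b) (of_real c)) = of_real (Delta f)"
        by (simp_all add: feq)
      then have "complex_of_real (eval4 R (b * x + 2 * c * y) (- 2 * a * x - b * y))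
          = (of_real (Delta f))^2 * of_real (eval4 R x y)"
        using aut[of "of_real x" "of_real y"] by (simp only: eval4_of_real)
      then show ?thesis by (simp only: of_real_eq_iff flip: of_real_power of_real_mult)
    qed
    have "subst4 R (b / s) (2 * c / s) (- 2 * a / s) (- b / s) = R"
    proof (rule eval4_inject)
      fix x y
      have "eval4 (subst4 R (b / s) (2 * c / s) (- 2 * a / s) (- b / s)) x y
          = eval4 R (1 / s * (b * x + 2 * c * y)) (1 / s * (- 2 * a * x - b * y))"
        unfolding eval4_subst4 by (simp add: add_divide_distrib diff_divide_distrib)
      \<comment> \<open>A quartic form turns the scaling by 1/s into s^(-4), which cancels (Delta
        f)^2.\<close>
      also have "\<dots> = eval4 R x y"
        unfolding eval4_mult eval using s \<Delta> s4 by (simp add: power_divide)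
      finally show "eval4 (subst4 R (b / s) (2 * c / s) (- 2 * a / s) (- b / s)) x y = eval4 R x y" .
    qed
    moreover have "\<forall>i j. U_mat f $ i $ j \<in> \<rat>"
      using f rationally_good_iff[OF \<Delta>] unfolding real_good_factor_def by blast
    ultimately show ?thesis
      unfolding feq U_mat_eq_mat2 unfolding feq[symmetric] s_def[symmetric] carrier_Aut_iff[OF F] R_def
      by (auto simp: forall_2)
  qed
  have conv: "T = mat 1 \<or> T = - mat 1 \<or> (\<exists>f. real_good_factor F f \<and> T = - U_mat f)"
    if T: "T \<in> carrier (Aut F)"
  proof -
    obtain t u v w where Teq: "T = mat2 t u v w" by (rule mat2_cases)
    have rat: "t \<in> \<rat>" "u \<in> \<rat>" "v \<in> \<rat>" "w \<in> \<rat>" and inv: "subst4 R t u v w = R"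
      using T unfolding Teq carrier_Aut_iff[OF F] R_def by auto
    have det: "(t * w - u * v)^2 = 1"
      using subst4_fixed_det[OF dR inv] .
    then have "complex_of_real ((t * w - u * v)^2) = of_real 1" by (simp only:)
    then have det': "(complex_of_real t * of_real w - of_real u * of_real v)^2 = 1"
      by simp
    have inv': "subst4 (map_quartic of_real R) (complex_of_real t) (of_real u) (of_real v) (of_real w)
        = map_quartic of_real R"
      unfolding subst4_of_real inv ..
    \<comment> \<open>Chosen so that the unnormalised matrix of f is -2 T when T has trace
      zero.\<close>
    define f where "f = Quadratic v (w - t) (- u)"
    have "u = 0 \<and> v = 0 \<and> w = t \<or> t + w = 0 \<and> significant_factor (map_quartic of_real R) (map_quadratic of_real f)"
      using automorphism_cases[OF bi inv' det'] unfolding f_def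
      by (auto simp: complex_eq_iff)
    then show ?thesis
    proof
      assume sc: "u = 0 \<and> v = 0 \<and> w = t"
      then have "(t * t)^2 = 1" using det by simp
      then have "t * t = 1" using zero_le_square[of t] by (auto simp: power2_eq_1_iff)
      then have "t = 1 \<or> t = - 1" by (simp add: square_eq_1_iff)
      then show ?thesis using sc by (auto simp: Teq mat_1_eq_mat2 uminus_mat2)
    next
      assume *: "t + w = 0 \<and> significant_factor (map_quartic of_real R) (map_quadratic of_real f)"
      have w: "w = - t" using * by simp
      \<comment> \<open>The normalising root is then 2, which cancels the 2 in -2 T.\<close>
      have "Delta f = - 4 * (t * w - u * v)"
        by (simp add: f_def w power2_eq_square algebra_simps)
      moreover have "\<bar>t * w - u * v\<bar> = 1" using det by (simp add: abs_square_eq_1)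
      ultimately have \<Delta>: "\<bar>Delta f\<bar> = 4" by (simp add: abs_mult)
      have "T = - U_mat f"
        using \<Delta> unfolding f_def U_mat_eq_mat2 by (simp add: Teq uminus_mat2 w del: Delta.simps)
      moreover have "rationally_good (map_quadratic complex_of_real f)"
      proof -
        have "U_mat f = - T" using \<open>T = - U_mat f\<close> by simp
        then show ?thesis
          using \<Delta> rat by (subst rationally_good_iff) (auto simp: Teq uminus_mat2 forall_2)
      qed
      ultimately show ?thesis using * unfolding real_good_factor_def C by blast
    qed
  qed
  show ?thesis using neg one good conv by blast
qed

section \<open>Isomorphism types\<close>

text \<open>The explicit isomorphisms below run from the model group to the matrices. The inverse
  map is multiplicative as soon as products in the model stay in its carrier.\<close>

lemma is_iso_sym_closed:
  assumes h: "h \<in> iso G H"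
    and closed: "\<And>x y. x \<in> carrier G \<Longrightarrow> y \<in> carrier G \<Longrightarrow> x \<otimes>\<^bsub>G\<^esub> y \<in> carrier G"
  shows "H \<cong> G"
proof (rule is_isoI)
  let ?k = "inv_into (carrier G) h"
  have bij: "bij_betw h (carrier G) (carrier H)" and hom: "h \<in> hom G H"
    using h by (simp_all add: iso_def)
  have k: "?k (h a) = a" if "a \<in> carrier G" for a
    using bij_betw_inv_into_left[OF bij that] .
  have "?k (x \<otimes>\<^bsub>H\<^esub> y) = ?k x \<otimes>\<^bsub>G\<^esub> ?k y" if xy: "x \<in> carrier H" "y \<in> carrier H" for x y
  proof -
    obtain a b where ab: "a \<in> carrier G" "x = h a" "b \<in> carrier G" "y = h b"
      using xy bij by (metis bij_betw_imp_surj_on imageE)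
    then have "x \<otimes>\<^bsub>H\<^esub> y = h (a \<otimes>\<^bsub>G\<^esub> b)" using hom by (simp add: hom_mult)
    then show ?thesis using ab k closed by simp
  qed
  moreover have "bij_betw ?k (carrier H) (carrier G)" by (rule bij_betw_inv_into[OF bij])
  ultimately show "?k \<in> iso H G"
    by (auto simp: iso_def hom_def dest: bij_betwE)
qed

lemma self_eq_uminus_iff: "X = - X \<longleftrightarrow> X = 0" for X :: "real^2^2"
  by (auto simp: vec_eq_iff)

lemma mat_1_neq: "(mat 1 :: real^2^2) \<noteq> - mat 1" "(mat 1 :: real^2^2) \<noteq> 0"
  by (simp_all add: vec_eq_iff forall_2 mat_def)

lemma mat_square_neq_0:
  fixes U :: "real^2^2"
  assumes "U ** U = mat 1 \<or> U ** U = - mat 1"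
  shows "U \<noteq> 0"
  using assms mat_1_neq by auto

lemma uminus_eq_swap: "- X = Y \<longleftrightarrow> X = - Y" for X :: "real^2^2"
  by (metis minus_minus)

text \<open>The isomorphism is (i, j) \<mapsto> (-1)^i U^j; injectivity follows by counting four
  distinct matrices.\<close>

lemma klein_four_iso:
  fixes U :: "real^2^2"
  assumes U2: "U ** U = mat 1" and U: "U \<noteq> mat 1" "U \<noteq> - mat 1"
  shows "GL2Q\<lparr>carrier := {mat 1, - mat 1, U, - U}\<rparr> \<cong> integer_mod_group 2 \<times>\<times> integer_mod_group 2"
proof (rule is_iso_sym_closed)
  define h :: "int \<times> int \<Rightarrow> real^2^2" where
    "h = (\<lambda>(i, j). (if i = 0 then mat 1 else - mat 1) ** (if j = 0 then mat 1 else U))"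
  have h: "h (0, 0) = mat 1" "h (1, 0) = - mat 1" "h (0, 1) = U" "h (1, 1) = - U"
    by (simp_all add: h_def matrix_mult_uminus)
  have c: "{0..<2::int} = {0, 1}" by auto
  have U0: "U \<noteq> - U" using mat_square_neq_0 U2 by (simp add: self_eq_uminus_iff)
  have img: "h ` ({0, 1} \<times> {0, 1}) = {mat 1, - mat 1, U, - U}"
    by (simp add: h insert_Times_insert insert_commute)
  have U': "mat 1 \<noteq> U" "mat 1 \<noteq> - U" using U by (auto simp: uminus_eq_swap)
  have "card {mat 1, - mat 1, U, - U} = 4"
    using U' U0 mat_1_neq by (simp add: card_insert_if uminus_eq_swap)
  then have "inj_on h ({0, 1} \<times> {0, 1})"
    using img by (intro eq_card_imp_inj_on) (simp_all add: card_cartesian_product)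
  then have "bij_betw h ({0, 1} \<times> {0, 1}) {mat 1, - mat 1, U, - U}"
    using img by (simp add: bij_betw_def)
  then show "h \<in> iso (integer_mod_group 2 \<times>\<times> integer_mod_group 2)
      (GL2Q\<lparr>carrier := {mat 1, - mat 1, U, - U}\<rparr>)"
    by (simp add: iso_def hom_def carrier_integer_mod_group c h matrix_mult_uminus U2)
qed (auto simp: carrier_integer_mod_group)

text \<open>The powers 1, U, -1, -U sweep the whole carrier, so i \<mapsto> U^i is the
  isomorphism.\<close>

lemma cyclic_four_iso:
  fixes U :: "real^2^2"
  assumes U2: "U ** U = - mat 1" and U: "U \<noteq> mat 1" "U \<noteq> - mat 1"
  shows "GL2Q\<lparr>carrier := {mat 1, - mat 1, U, - U}\<rparr> \<cong> integer_mod_group 4"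
proof (rule is_iso_sym_closed)
  define h :: "int \<Rightarrow> real^2^2" where
    "h i = (if i = 0 then mat 1 else if i = 1 then U else if i = 2 then - mat 1 else - U)" for i
  have h: "h 0 = mat 1" "h 1 = U" "h 2 = - mat 1" "h 3 = - U"
    by (simp_all add: h_def)
  have c: "{0..<4::int} = {0, 1, 2, 3}" by auto
  have U0: "U \<noteq> - U" using mat_square_neq_0 U2 by (simp add: self_eq_uminus_iff)
  have img: "h ` {0, 1, 2, 3} = {mat 1, - mat 1, U, - U}"
    by (simp add: h insert_commute)
  have U': "mat 1 \<noteq> U" "mat 1 \<noteq> - U" using U by (auto simp: uminus_eq_swap)
  have "card {mat 1, - mat 1, U, - U} = 4"
    using U' U0 mat_1_neq by (simp add: card_insert_if uminus_eq_swap)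
  then have "inj_on h {0, 1, 2, 3}"
    using img by (intro eq_card_imp_inj_on) simp_all
  then have "bij_betw h {0, 1, 2, 3} {mat 1, - mat 1, U, - U}"
    using img by (simp add: bij_betw_def)
  then show "h \<in> iso (integer_mod_group 4) (GL2Q\<lparr>carrier := {mat 1, - mat 1, U, - U}\<rparr>)"
    by (simp add: iso_def hom_def carrier_integer_mod_group c h matrix_mult_uminus U2)
qed (auto simp: carrier_integer_mod_group)

text \<open>Two such matrices generate a dihedral group of order 8: their product squares to -1 and
  is inverted under conjugation by either of them.\<close>

locale anticommuting_involutions =
  fixes A B :: "real^2^2"
  assumes A2: "A ** A = mat 1" and B2: "B ** B = mat 1" and anti: "A ** B = - (B ** A)"
begin

definition R where "R = A ** B"

lemma R_mult: "A ** R = B" "R ** A = - B" "R ** B = A" "R ** R = - mat 1" "B ** R = - A"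
proof -
  show 1: "A ** R = B" by (simp add: R_def matrix_mul_assoc A2)
  show 2: "R ** A = - B"
    unfolding R_def anti by (simp add: matrix_mult_uminus A2 flip: matrix_mul_assoc)
  show 3: "R ** B = A" by (simp add: R_def B2 flip: matrix_mul_assoc)
  have "R ** R = (R ** A) ** B" by (simp add: R_def matrix_mul_assoc)
  then show "R ** R = - mat 1" by (simp add: 2 matrix_mult_uminus B2)
  show "B ** R = - A"
    by (simp add: R_def anti matrix_mult_uminus matrix_mul_assoc B2)
qed

text \<open>For an anticommuting pair S, T, the equation S = \<plusminus>1 would force T = -T, and S
  = \<plusminus>T would force T^2 = -T^2.\<close>

lemma distinct:
  "A \<noteq> - A" "B \<noteq> - B" "R \<noteq> - R" "mat 1 \<noteq> A" "mat 1 \<noteq> - A" "mat 1 \<noteq> B" "mat 1 \<noteq> - B"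
  "mat 1 \<noteq> R" "mat 1 \<noteq> - R" "A \<noteq> B" "A \<noteq> - B" "A \<noteq> R" "A \<noteq> - R" "B \<noteq> R" "B \<noteq> - R"
proof -
  have nz: "A \<noteq> 0" "B \<noteq> 0" "R \<noteq> 0"
    using A2 B2 R_mult(4) mat_square_neq_0 by blast+
  then show "A \<noteq> - A" "B \<noteq> - B" "R \<noteq> - R" by (simp_all add: self_eq_uminus_iff)
  have sq: "S \<noteq> mat 1" "S \<noteq> - mat 1" if S: "S ** T = - (T ** S)" "T \<noteq> 0" for S T :: "real^2^2"
  proof -
    have "T \<noteq> - T" using S(2) self_eq_uminus_iff by blast
    then show "S \<noteq> mat 1" "S \<noteq> - mat 1"
      using S(1) by (metis matrix_mul_lid matrix_mul_rid matrix_mult_uminus minus_minus)+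
  qed
  have anti': "B ** A = - (A ** B)" by (simp add: anti)
  have antiR: "R ** A = - (A ** R)" by (simp add: R_mult)
  show "mat 1 \<noteq> A" "mat 1 \<noteq> - A" "mat 1 \<noteq> B" "mat 1 \<noteq> - B" "mat 1 \<noteq> R" "mat 1 \<noteq> - R"
    using sq[OF anti nz(2)] sq[OF anti' nz(1)] sq[OF antiR nz(1)] by (metis minus_minus)+
  have ne: "S \<noteq> T" "S \<noteq> - T" if S: "S ** T = - (T ** S)" "T ** T \<noteq> 0" for S T :: "real^2^2"
  proof -
    have "T ** T \<noteq> - (T ** T)" using S(2) self_eq_uminus_iff by blast
    then show "S \<noteq> T" "S \<noteq> - T"
      using S(1) by (metis matrix_mult_uminus minus_minus)+
  qed
  have antiR': "A ** R = - (R ** A)" "B ** R = - (R ** B)"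
    by (simp_all add: R_mult)
  show "A \<noteq> B" "A \<noteq> - B" "A \<noteq> R" "A \<noteq> - R" "B \<noteq> R" "B \<noteq> - R"
    using ne[OF anti] ne[OF antiR'(1)] ne[OF antiR'(2)] mat_1_neq by (simp_all add: B2 R_mult(4))
qed

text \<open>The pair (i, s) goes to R^i A^s, with \<open>R\<close> as the rotation and
  \<open>A\<close> as the reflection.\<close>

lemma dihedral_iso:
  "GL2Q\<lparr>carrier := {mat 1, - mat 1, A, - A, B, - B, R, - R}\<rparr> \<cong> dihedral_group 4"
proof (rule is_iso_sym_closed)
  define r :: "int \<Rightarrow> real^2^2" where
    "r i = (if i = 0 then mat 1 else if i = 1 then R else if i = 2 then - mat 1 else - R)" for i
  define h :: "int \<times> bool \<Rightarrow> real^2^2" where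
    "h = (\<lambda>(i, s). r i ** (if s then A else mat 1))"
  have c: "{0..<4::int} = {0, 1, 2, 3}" by auto
  have r: "r 0 = mat 1" "r 1 = R" "r 2 = - mat 1" "r 3 = - R"
    by (simp_all add: r_def)
  have rr: "r i ** r j = r ((i + j) mod 4)" if "i \<in> {0, 1, 2, 3}" "j \<in> {0, 1, 2, 3}" for i j
    using that unfolding insert_iff empty_iff
    by (elim disjE FalseE) (simp_all add: r matrix_mult_uminus R_mult)
  \<comment> \<open>The dihedral relation A R A = R^(-1), in the form R^i A R^j = R^(i - j) A with
    exponents modulo 4.\<close>
  have Ar: "r i ** A ** r j = r ((i - j) mod 4) ** A" if "i \<in> {0, 1, 2, 3}" "j \<in> {0, 1, 2, 3}" for i j
    using that unfolding insert_iff empty_iff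
    by (elim disjE FalseE) (simp_all add: r matrix_mult_uminus R_mult flip: matrix_mul_assoc)
  have hom: "h ((if s then i - j else i + j) mod 4, s \<noteq> t) = h (i, s) ** h (j, t)"
    if "i \<in> {0, 1, 2, 3}" "j \<in> {0, 1, 2, 3}" for i j s t
  proof (cases s)
    case True
    then have "h (i, s) ** h (j, t) = (r i ** A ** r j) ** (if t then A else mat 1)"
      by (simp add: h_def matrix_mul_assoc)
    then show ?thesis
      unfolding Ar[OF that] using True by (simp add: h_def A2 flip: matrix_mul_assoc)
  next
    case False
    then have "h (i, s) ** h (j, t) = (r i ** r j) ** (if t then A else mat 1)"
      by (simp add: h_def matrix_mul_assoc)
    then show ?thesis
      unfolding rr[OF that] using False by (simp add: h_def)
  qed
  have img: "h ` ({0, 1, 2, 3} \<times> UNIV) = {mat 1, - mat 1, A, - A, B, - B, R, - R}"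
  proof -
    have "h ` ({0, 1, 2, 3} \<times> UNIV) = (\<lambda>i. h (i, False)) ` {0, 1, 2, 3} \<union> (\<lambda>i. h (i, True)) ` {0, 1, 2, 3}"
      by (auto simp: UNIV_bool)
    then show ?thesis by (simp add: h_def r matrix_mult_uminus R_mult) blast
  qed
  have "card {mat 1, - mat 1, A, - A, B, - B, R, - R} = 8"
    using distinct mat_1_neq by (simp add: card_insert_if uminus_eq_swap)
  then have "card (h ` ({0, 1, 2, 3} \<times> UNIV)) = card ({0, 1, 2, 3 :: int} \<times> (UNIV :: bool set))"
    unfolding img by (simp add: card_cartesian_product)
  then have "inj_on h ({0, 1, 2, 3} \<times> UNIV)"
    by (intro eq_card_imp_inj_on) simp_all
  with img have "bij_betw h ({0, 1, 2, 3} \<times> UNIV) {mat 1, - mat 1, A, - A, B, - B, R, - R}"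
    by (simp add: bij_betw_def)
  moreover have car: "carrier (dihedral_group 4) = {0, 1, 2, 3} \<times> UNIV"
    by (simp add: dihedral_group_def carrier_integer_mod_group c)
  ultimately have bij: "bij_betw h (carrier (dihedral_group 4)) {mat 1, - mat 1, A, - A, B, - B, R, - R}"
    by simp
  show "h \<in> iso (dihedral_group 4) (GL2Q\<lparr>carrier := {mat 1, - mat 1, A, - A, B, - B, R, - R}\<rparr>)"
  proof (rule isoI, rule homI)
    fix x y assume "x \<in> carrier (dihedral_group 4)" "y \<in> carrier (dihedral_group 4)"
    moreover obtain i s j t where xy: "x = (i, s)" "y = (j, t)" by (cases x, cases y)
    ultimately have "i \<in> {0, 1, 2, 3}" "j \<in> {0, 1, 2, 3}"
      unfolding car by blast+
    from hom[OF this] show "h (x \<otimes>\<^bsub>dihedral_group 4\<^esub> y)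
        = h x \<otimes>\<^bsub>GL2Q\<lparr>carrier := {mat 1, - mat 1, A, - A, B, - B, R, - R}\<rparr>\<^esub> h y"
      unfolding xy by (simp add: dihedral_group_def)
  qed (use bij bij_betwE[OF bij] in simp_all)
next
  show "x \<otimes>\<^bsub>dihedral_group 4\<^esub> y \<in> carrier (dihedral_group 4)"
    if "x \<in> carrier (dihedral_group 4)" "y \<in> carrier (dihedral_group 4)" for x y
    by (simp add: dihedral_group_def carrier_integer_mod_group split: prod.splits)
qed

text \<open>Closure determines the last pair: the product of \<open>A\<close> and \<open>B\<close>
  differs from the first six matrices, so it is \<open>C\<close> up to sign.\<close>

lemma dihedral_iso_closed:
  assumes "A ** B \<in> {mat 1, - mat 1, A, - A, B, - B, C, - C}"
  shows "GL2Q\<lparr>carrier := {mat 1, - mat 1, A, - A, B, - B, C, - C}\<rparr> \<cong> dihedral_group 4"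
proof -
  have "R = C \<or> R = - C"
    using assms distinct unfolding R_def[symmetric] by (auto simp: uminus_eq_swap)
  then have "{mat 1, - mat 1, A, - A, B, - B, C, - C} = {mat 1, - mat 1, A, - A, B, - B, R, - R}"
    by auto
  then show ?thesis using dihedral_iso by simp
qed

end

section \<open>Factorisations of the sextic over the real and over the complex numbers\<close>

lemma eval2_prod3:
  fixes x y :: "'a::idom"
  shows "eval2 (Quadratic a1 b1 c1) x y * eval2 (Quadratic a2 b2 c2) x y * eval2 (Quadratic a3 b3 c3) x y =
    a1 * a2 * a3 * x^6 + (b1 * a2 * a3 + a1 * b2 * a3 + a1 * a2 * b3) * x^5 * y
    + (c1 * a2 * a3 + a1 * c2 * a3 + a1 * a2 * c3 + b1 * b2 * a3 + b1 * a2 * b3 + a1 * b2 * b3) * x^4 * y^2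
    + (b1 * b2 * b3 + a1 * b2 * c3 + a1 * c2 * b3 + b1 * a2 * c3 + c1 * a2 * b3 + b1 * c2 * a3 + c1 * b2 * a3)
      * x^3 * y^3
    + (a1 * c2 * c3 + c1 * a2 * c3 + c1 * c2 * a3 + b1 * b2 * c3 + b1 * c2 * b3 + c1 * b2 * b3) * x^2 * y^4
    + (b1 * c2 * c3 + c1 * b2 * c3 + c1 * c2 * b3) * x * y^5 + c1 * c2 * c3 * y^6"
  by (simp, algebra)

lemma proportional_refl: "proportional f f" for f :: "'a::idom quadratic"
  unfolding proportional_def by (cases f) (intro exI[of _ 1], simp)

lemma sextic_form_inject:
  fixes p :: "nat \<Rightarrow> 'a::{idom,ring_char_0}"
  assumes "\<And>x y. p 6 * x^6 + p 5 * x^5 * y + p 4 * x^4 * y^2 + p 3 * x^3 * y^3 + p 2 * x^2 * y^4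
      + p 1 * x * y^5 + p 0 * y^6
    = q 6 * x^6 + q 5 * x^5 * y + q 4 * x^4 * y^2 + q 3 * x^3 * y^3 + q 2 * x^2 * y^4
      + q 1 * x * y^5 + q 0 * y^6"
  shows "p 6 = q 6" "p 5 = q 5" "p 4 = q 4" "p 3 = q 3" "p 2 = q 2" "p 1 = q 1" "p 0 = q 0"
proof -
  have "poly [:p 0, p 1, p 2, p 3, p 4, p 5, p 6:] x = poly [:q 0, q 1, q 2, q 3, q 4, q 5, q 6:] x" for x
    using assms[of x 1] by (simp add: algebra_simps eval_nat_numeral)
  then have "[:p 0, p 1, p 2, p 3, p 4, p 5, p 6:] = [:q 0, q 1, q 2, q 3, q 4, q 5, q 6:]"
    using poly_eq_poly_eq_iff by blast
  then show "p 6 = q 6" "p 5 = q 5" "p 4 = q 4" "p 3 = q 3" "p 2 = q 2" "p 1 = q 1" "p 0 = q 0"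
    by simp_all
qed

text \<open>The identity is known at real arguments and wanted at complex ones; it passes through
  the equality of the seven coefficients.\<close>

lemma sextic_factorization_of_real:
  fixes F :: "real quartic"
  assumes eq: "\<And>x y. sextic_covariant F x y = eval2 f1 x y * eval2 f2 x y * eval2 f3 x y"
  shows "sextic_covariant (map_quartic complex_of_real F) x y =
    eval2 (map_quadratic of_real f1) x y * eval2 (map_quadratic of_real f2) x y
      * eval2 (map_quadratic of_real f3) x y"
proof -
  obtain a4 a3 a2 a1 a0 where F: "F = Quartic a4 a3 a2 a1 a0" by (cases F)
  obtain a b c a' b' c' a'' b'' c'' where
    f: "f1 = Quadratic a b c" "f2 = Quadratic a' b' c'" "f3 = Quadratic a'' b'' c''"
    by (cases f1, cases f2, cases f3)
  \<comment> \<open>In both lists the index is the exponent of x.\<close>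
  define p where "p i = [- (a1^3 + 8 * a3 * a0^2 - 4 * a2 * a1 * a0),
    - (2 * (16 * a4 * a0^2 + 2 * a3 * a1 * a0 - 4 * a2^2 * a0 + a2 * a1^2)),
    - (5 * (8 * a4 * a1 * a0 + a3 * a1^2 - 4 * a3 * a2 * a0)),
    20 * (a3^2 * a0 - a4 * a1^2),
    5 * (8 * a4 * a3 * a0 + a3^2 * a1 - 4 * a4 * a2 * a1),
    2 * (16 * a4^2 * a0 + 2 * a4 * a3 * a1 - 4 * a4 * a2^2 + a3^2 * a2),
    a3^3 + 8 * a4^2 * a1 - 4 * a4 * a3 * a2] ! i" for i
  define q where "q i = [c * c' * c'', b * c' * c'' + c * b' * c'' + c * c' * b'',
    a * c' * c'' + c * a' * c'' + c * c' * a'' + b * b' * c'' + b * c' * b'' + c * b' * b'',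
    b * b' * b'' + a * b' * c'' + a * c' * b'' + b * a' * c'' + c * a' * b'' + b * c' * a'' + c * b' * a'',
    c * a' * a'' + a * c' * a'' + a * a' * c'' + b * b' * a'' + b * a' * b'' + a * b' * b'',
    b * a' * a'' + a * b' * a'' + a * a' * b'', a * a' * a''] ! i" for i
  have p: "p 6 = a3^3 + 8 * a4^2 * a1 - 4 * a4 * a3 * a2"
    "p 5 = 2 * (16 * a4^2 * a0 + 2 * a4 * a3 * a1 - 4 * a4 * a2^2 + a3^2 * a2)"
    "p 4 = 5 * (8 * a4 * a3 * a0 + a3^2 * a1 - 4 * a4 * a2 * a1)"
    "p 3 = 20 * (a3^2 * a0 - a4 * a1^2)"
    "p 2 = - (5 * (8 * a4 * a1 * a0 + a3 * a1^2 - 4 * a3 * a2 * a0))"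
    "p 1 = - (2 * (16 * a4 * a0^2 + 2 * a3 * a1 * a0 - 4 * a2^2 * a0 + a2 * a1^2))"
    "p 0 = - (a1^3 + 8 * a3 * a0^2 - 4 * a2 * a1 * a0)"
    by (simp_all add: p_def)
  have q: "q 6 = a * a' * a''" "q 5 = b * a' * a'' + a * b' * a'' + a * a' * b''"
    "q 4 = c * a' * a'' + a * c' * a'' + a * a' * c'' + b * b' * a'' + b * a' * b'' + a * b' * b''"
    "q 3 = b * b' * b'' + a * b' * c'' + a * c' * b'' + b * a' * c'' + c * a' * b'' + b * c' * a'' + c * b' * a''"
    "q 2 = a * c' * c'' + c * a' * c'' + c * c' * a'' + b * b' * c'' + b * c' * b'' + c * b' * b''"
    "q 1 = b * c' * c'' + c * b' * c'' + c * c' * b''" "q 0 = c * c' * c''"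
    by (simp_all add: q_def)
  have P: "sextic_covariant F x y = p 6 * x^6 + p 5 * x^5 * y + p 4 * x^4 * y^2 + p 3 * x^3 * y^3
      + p 2 * x^2 * y^4 + p 1 * x * y^5 + p 0 * y^6" for x y
    unfolding F sextic_covariant.simps p by (simp only: mult_minus_left diff_conv_add_uminus)
  have Q: "eval2 f1 x y * eval2 f2 x y * eval2 f3 x y = q 6 * x^6 + q 5 * x^5 * y + q 4 * x^4 * y^2
      + q 3 * x^3 * y^3 + q 2 * x^2 * y^4 + q 1 * x * y^5 + q 0 * y^6" for x y
    unfolding f eval2_prod3 q ..
  have pq: "p 6 = q 6" "p 5 = q 5" "p 4 = q 4" "p 3 = q 3" "p 2 = q 2" "p 1 = q 1" "p 0 = q 0"
    using sextic_form_inject[of p q] eq unfolding P Q by blast+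
  have "sextic_covariant (map_quartic complex_of_real F) x y = of_real (p 6) * x^6 + of_real (p 5) * x^5 * y
      + of_real (p 4) * x^4 * y^2 + of_real (p 3) * x^3 * y^3 + of_real (p 2) * x^2 * y^4
      + of_real (p 1) * x * y^5 + of_real (p 0) * y^6"
    unfolding F quartic.map sextic_covariant.simps p
    by (simp only: of_real_mult of_real_add of_real_diff of_real_minus of_real_power of_real_numeral
        mult_minus_left diff_conv_add_uminus)
  also have "\<dots> = eval2 (map_quadratic of_real f1) x y * eval2 (map_quadratic of_real f2) x y
      * eval2 (map_quadratic of_real f3) x y"
    unfolding f quadratic.map eval2_prod3 pq q by simp
  finally show ?thesis .
qed

text \<open>Descends the complex statements to real forms. The constant k is complex at first; it is
  real because the sextic and the product of the three forms are real and the product does not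
  vanish identically.\<close>

lemma three_good_factors:
  assumes F: "disc4 F \<noteq> 0"
    and good: "real_good_factor F f1" "real_good_factor F f2" "real_good_factor F f3"
    and ne: "\<not> proportional f1 f2" "\<not> proportional f1 f3" "\<not> proportional f2 f3"
  shows "\<And>g. real_good_factor F g \<Longrightarrow> proportional g f1 \<or> proportional g f2 \<or> proportional g f3"
    and "polar f1 f2 = 0" "polar f1 f3 = 0" "polar f2 f3 = 0"
    and "\<exists>k. k \<noteq> 0 \<and> (\<forall>x y. sextic_covariant (map_quartic of_int F) x y
           = k * (eval2 f1 x y * eval2 f2 x y * eval2 f3 x y))"
proof -
  let ?c = "map_quadratic complex_of_real"
  note bi = biquadratic_equiv_of_int[OF F]
  have \<Delta>: "Delta f1 \<noteq> 0" "Delta f2 \<noteq> 0" "Delta f3 \<noteq> 0"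
    using real_good_factor_Delta[OF F] good by blast+
  have sig: "significant_factor (map_quartic of_int F) (?c f1)"
    "significant_factor (map_quartic of_int F) (?c f2)"
    "significant_factor (map_quartic of_int F) (?c f3)"
    using good unfolding real_good_factor_def by blast+
  have ne': "\<not> proportional (?c f1) (?c f2)" "\<not> proportional (?c f1) (?c f3)"
    "\<not> proportional (?c f2) (?c f3)"
    using ne proportional_of_real \<Delta> by blast+
  show "proportional g f1 \<or> proportional g f2 \<or> proportional g f3" if "real_good_factor F g" for g
    using significant_factors_exhaust(1)[OF bi sig ne', of "?c g"] that proportional_of_real \<Delta>
    unfolding real_good_factor_def by blast
  show "polar f1 f2 = 0" "polar f1 f3 = 0" "polar f2 f3 = 0"
    using significant_factor_polar[OF bi sig(1,2) ne'(1)] significant_factor_polar[OF bi sig(1,3) ne'(2)]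
      significant_factor_polar[OF bi sig(2,3) ne'(3)] by (simp_all add: polar_of_real)
  obtain k where k: "k \<noteq> 0" and prod: "\<And>x y. sextic_covariant (map_quartic of_int F) x y
      = k * (eval2 (?c f1) x y * eval2 (?c f2) x y * eval2 (?c f3) x y)"
    using significant_factors_exhaust(2)[OF bi sig ne'] by blast
  have eq: "complex_of_real (sextic_covariant (map_quartic of_int F) x y)
      = k * of_real (eval2 f1 x y * eval2 f2 x y * eval2 f3 x y)" for x y
    using prod[of "of_real x" "of_real y"]
    unfolding map_quartic_of_int_complex sextic_covariant_of_real eval2_of_real by simp
  have "Im k = 0"
  proof (rule ccontr)
    assume "Im k \<noteq> 0"
    then have z: "eval2 f1 x y * eval2 f2 x y * eval2 f3 x y = 0" for x y
      using arg_cong[OF eq[of x y], of Im] by simp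
    obtain a1 b1 c1 a2 b2 c2 a3 b3 c3 where
      f: "f1 = Quadratic a1 b1 c1" "f2 = Quadratic a2 b2 c2" "f3 = Quadratic a3 b3 c3"
      by (cases f1, cases f2, cases f3)
    \<comment> \<open>Dehomogenised at y = 1, a vanishing product makes one of the three forms zero,
      against its non-zero \<open>Delta\<close>.\<close>
    have "poly ([:c1, b1, a1:] * [:c2, b2, a2:] * [:c3, b3, a3:]) x = 0" for x
    proof -
      have "poly [:c1, b1, a1:] x = eval2 f1 x 1" "poly [:c2, b2, a2:] x = eval2 f2 x 1"
        "poly [:c3, b3, a3:] x = eval2 f3 x 1"
        unfolding f by (simp_all add: algebra_simps power2_eq_square)
      then show ?thesis using z[of x 1] by (simp only: poly_mult)
    qed
    then have "[:c1, b1, a1:] * [:c2, b2, a2:] * [:c3, b3, a3:] = 0"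
      using poly_all_0_iff_0 by blast
    then have "[:c1, b1, a1:] = 0 \<or> [:c2, b2, a2:] = 0 \<or> [:c3, b3, a3:] = 0"
      by (simp only: mult_eq_0_iff disj_assoc)
    then show False using \<Delta> unfolding f by auto
  qed
  then have kr: "k = of_real (Re k)" by (simp add: complex_eq_iff)
  have "sextic_covariant (map_quartic of_int F) x y
      = Re k * (eval2 f1 x y * eval2 f2 x y * eval2 f3 x y)" for x y
    using arg_cong[OF eq[of x y], of Re] \<open>Im k = 0\<close> by simp
  moreover have "Re k \<noteq> 0" using k kr by auto
  ultimately show "\<exists>k. k \<noteq> 0 \<and> (\<forall>x y. sextic_covariant (map_quartic of_int F) x y
           = k * (eval2 f1 x y * eval2 f2 x y * eval2 f3 x y))" by blast
qed

section \<open>From the list of automorphisms to the three statements\<close>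

lemma Aut_eq_carrier_update: "Aut F = GL2Q\<lparr>carrier := carrier (Aut F)\<rparr>"
  by (simp add: Aut_def)

lemma carrier_Aut_unique:
  assumes F: "disc4 F \<noteq> 0" and f: "real_good_factor F f"
    and uniq: "\<And>g. real_good_factor F g \<Longrightarrow> proportional g f"
  shows "carrier (Aut F) = {mat 1, - mat 1, U_mat f, - U_mat f}"
proof -
  have "T \<in> carrier (Aut F) \<longleftrightarrow> T \<in> {mat 1, - mat 1, U_mat f, - U_mat f}" for T
    unfolding carrier_Aut[OF F] using f uniq U_mat_proportional by fastforce
  then show ?thesis by blast
qed

text \<open>As \<open>U_mat f\<close> is not \<plusminus>1, it is \<plusminus>\<open>U_mat g\<close>
  for a good g, and the matrix determines the form up to a scalar.\<close>

lemma good_factor_if_U_mat_in_Aut: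
  assumes F: "disc4 F \<noteq> 0" and f: "Delta f \<noteq> 0" "U_mat f \<in> carrier (Aut F)"
  shows "real_good_factor F f"
proof -
  obtain g where g: "real_good_factor F g" and "U_mat f = U_mat g \<or> U_mat f = - U_mat g"
    using f(2) U_mat_neq_scalar[OF f(1)] unfolding carrier_Aut[OF F] by blast
  then have "proportional f g"
    using proportional_if_U_mat_eq f(1) real_good_factor_Delta[OF F] by blast
  then show ?thesis using real_good_factor_proportional[OF F] g by blast
qed

lemma Aut_mult_closed:
  assumes F: "disc4 F \<noteq> 0" and "S \<in> carrier (Aut F)" "T \<in> carrier (Aut F)"
  shows "S ** T \<in> carrier (Aut F)"
proof -
  obtain t u v w where S: "S = mat2 t u v w" by (rule mat2_cases)
  obtain t' u' v' w' where T: "T = mat2 t' u' v' w'" by (rule mat2_cases)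
  let ?G = "map_quartic real_of_int F"
  have "subst4 (subst4 ?G t u v w) t' u' v' w' = ?G"
    using assms(2,3) unfolding S T carrier_Aut_iff[OF F] by metis
  then show ?thesis
    using assms(2,3) unfolding S T mat2_mult carrier_Aut_iff[OF F] subst4_subst4 by simp
qed

text \<open>With \<open>Delta f = 0\<close> the division by zero would make \<open>U_mat f\<close>
  the zero matrix, hence the conditions on \<open>Delta\<close>. The third equivalence speaks of
  proportional forms because a matrix fixes its form only up to a scalar, whereas the factorisation
  fixes the product exactly.\<close>

theorem theorem4p1:
  fixes F :: "int quartic"
  assumes "disc4 F \<noteq> 0"
  shows
    "(carrier (Aut F) = {mat 1, - mat 1} \<longleftrightarrow> \<not> (\<exists>f. real_good_factor F f)) \<and>
     (\<forall>f. Delta f \<noteq> 0 \<and> U_mat f \<in> carrier GL2Q \<and>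
            carrier (Aut F) = generate GL2Q {U_mat f, - mat 1}
          \<longleftrightarrow> real_good_factor F f \<and> (\<forall>g. real_good_factor F g \<longrightarrow> proportional g f)) \<and>
     ((\<exists>f. real_good_factor F f \<and> (\<forall>g. real_good_factor F g \<longrightarrow> proportional g f)) \<longrightarrow>
          Aut F \<cong> integer_mod_group 2 \<times>\<times> integer_mod_group 2 \<or> Aut F \<cong> integer_mod_group 4) \<and>
     (\<forall>f1 f2 f3.
          Delta f1 \<noteq> 0 \<and> Delta f2 \<noteq> 0 \<and> Delta f3 \<noteq> 0 \<and>
          carrier (Aut F) =
            {mat 1, - mat 1, U_mat f1, - U_mat f1, U_mat f2, - U_mat f2, U_mat f3, - U_mat f3} \<and>
          Aut F \<cong> dihedral_group 4
          \<longleftrightarrow> (\<exists>g1 g2 g3. proportional g1 f1 \<and> proportional g2 f2 \<and> proportional g3 f3 \<and>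
                real_good_factor F g1 \<and> real_good_factor F g2 \<and> real_good_factor F g3 \<and>
                (\<forall>x y. sextic_covariant (map_quartic of_int F) x y
                       = eval2 g1 x y * eval2 g2 x y * eval2 g3 x y)))"
proof (intro conjI allI)
  have F: "disc4 F \<noteq> 0" by fact
  note \<Delta> = real_good_factor_Delta[OF F]
  have sq: "U_mat f ** U_mat f = mat 1 \<or> U_mat f ** U_mat f = - mat 1" if "Delta f \<noteq> 0" for f
    using U_mat_square[OF that] by (auto split: if_splits)
  show "carrier (Aut F) = {mat 1, - mat 1} \<longleftrightarrow> \<not> (\<exists>f. real_good_factor F f)"
  proof
    assume *: "carrier (Aut F) = {mat 1, - mat 1}"
    show "\<not> (\<exists>f. real_good_factor F f)"
    proof
      assume "\<exists>f. real_good_factor F f"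
      then obtain f where f: "real_good_factor F f" ..
      then have "U_mat f \<in> {mat 1, - mat 1}" unfolding *[symmetric] carrier_Aut[OF F] by blast
      then show False using U_mat_neq_scalar[OF \<Delta>[OF f]] by blast
    qed
  next
    assume "\<not> (\<exists>f. real_good_factor F f)"
    then have "T \<in> carrier (Aut F) \<longleftrightarrow> T \<in> {mat 1, - mat 1}" for T
      unfolding carrier_Aut[OF F] by blast
    then show "carrier (Aut F) = {mat 1, - mat 1}" by blast
  qed
  show "Delta f \<noteq> 0 \<and> U_mat f \<in> carrier GL2Q \<and> carrier (Aut F) = generate GL2Q {U_mat f, - mat 1}
      \<longleftrightarrow> real_good_factor F f \<and> (\<forall>g. real_good_factor F g \<longrightarrow> proportional g f)" for f
  proof
    assume "Delta f \<noteq> 0 \<and> U_mat f \<in> carrier GL2Q \<and> carrier (Aut F) = generate GL2Q {U_mat f, - mat 1}"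
    then have f: "Delta f \<noteq> 0" and c: "carrier (Aut F) = {mat 1, - mat 1, U_mat f, - U_mat f}"
      using generate_square_root sq by auto
    have "proportional g f" if g: "real_good_factor F g" for g
    proof -
      have "U_mat g \<in> {mat 1, - mat 1, U_mat f, - U_mat f}"
        using g unfolding c[symmetric] carrier_Aut[OF F] by blast
      then have "U_mat g = U_mat f \<or> U_mat g = - U_mat f"
        using U_mat_neq_scalar[OF \<Delta>[OF g]] by blast
      then show ?thesis using proportional_if_U_mat_eq \<Delta>[OF g] f by blast
    qed
    then show "real_good_factor F f \<and> (\<forall>g. real_good_factor F g \<longrightarrow> proportional g f)"
      using good_factor_if_U_mat_in_Aut[OF F f] c by blast
  next
    assume *: "real_good_factor F f \<and> (\<forall>g. real_good_factor F g \<longrightarrow> proportional g f)"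
    then have f: "Delta f \<noteq> 0" using \<Delta> by blast
    have c: "carrier (Aut F) = {mat 1, - mat 1, U_mat f, - U_mat f}"
      using carrier_Aut_unique[OF F] * by blast
    moreover have "carrier (Aut F) \<subseteq> carrier GL2Q" by (auto simp: Aut_def)
    ultimately have U: "U_mat f \<in> carrier GL2Q" by blast
    then show "Delta f \<noteq> 0 \<and> U_mat f \<in> carrier GL2Q \<and>
        carrier (Aut F) = generate GL2Q {U_mat f, - mat 1}"
      using f c generate_square_root[OF U sq[OF f]] by simp
  qed
  show "(\<exists>f. real_good_factor F f \<and> (\<forall>g. real_good_factor F g \<longrightarrow> proportional g f)) \<longrightarrow>
      Aut F \<cong> integer_mod_group 2 \<times>\<times> integer_mod_group 2 \<or> Aut F \<cong> integer_mod_group 4"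
  proof
    assume "\<exists>f. real_good_factor F f \<and> (\<forall>g. real_good_factor F g \<longrightarrow> proportional g f)"
    then obtain f where f: "real_good_factor F f" "\<And>g. real_good_factor F g \<Longrightarrow> proportional g f"
      by blast
    show "Aut F \<cong> integer_mod_group 2 \<times>\<times> integer_mod_group 2 \<or> Aut F \<cong> integer_mod_group 4"
      using sq[OF \<Delta>[OF f(1)]] klein_four_iso[OF _ U_mat_neq_scalar[OF \<Delta>[OF f(1)]]]
        cyclic_four_iso[OF _ U_mat_neq_scalar[OF \<Delta>[OF f(1)]]]
      by (subst (1 2) Aut_eq_carrier_update) (auto simp only: carrier_Aut_unique[OF F f])
  qed
  fix f1 f2 f3
  let ?S = "{mat 1, - mat 1, U_mat f1, - U_mat f1, U_mat f2, - U_mat f2, U_mat f3, - U_mat f3}"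
  show "Delta f1 \<noteq> 0 \<and> Delta f2 \<noteq> 0 \<and> Delta f3 \<noteq> 0 \<and> carrier (Aut F) = ?S \<and> Aut F \<cong> dihedral_group 4
    \<longleftrightarrow> (\<exists>g1 g2 g3. proportional g1 f1 \<and> proportional g2 f2 \<and> proportional g3 f3 \<and>
          real_good_factor F g1 \<and> real_good_factor F g2 \<and> real_good_factor F g3 \<and>
          (\<forall>x y. sextic_covariant (map_quartic of_int F) x y
                 = eval2 g1 x y * eval2 g2 x y * eval2 g3 x y))" (is "?L \<longleftrightarrow> ?R")
  proof
    assume ?L
    then have f: "Delta f1 \<noteq> 0" "Delta f2 \<noteq> 0" "Delta f3 \<noteq> 0" and c: "carrier (Aut F) = ?S"
      and iso: "Aut F \<cong> dihedral_group 4" by blast+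
    have good: "real_good_factor F f1" "real_good_factor F f2" "real_good_factor F f3"
      using good_factor_if_U_mat_in_Aut[OF F] f c by blast+
    \<comment> \<open>Counting against the dihedral group shows that all listed matrices are
      distinct; two proportional forms would leave at most six.\<close>
    have "card ?S = 8"
      using iso_same_card[OF iso] unfolding c
      by (simp add: dihedral_group_def carrier_integer_mod_group card_cartesian_product)
    have six: False if "?S = {mat 1, - mat 1, S, - S, T, - T}" for S T :: "real^2^2"
    proof -
      have "card {mat 1, - mat 1, S, - S, T, - T} \<le> 6"
        using card_length[of "[mat 1, - mat 1, S, - S, T, - T]"] by simp
      then show False using that \<open>card ?S = 8\<close> by simp
    qed
    have ne: "\<not> proportional f1 f2" "\<not> proportional f1 f3" "\<not> proportional f2 f3"
    proof -
      show "\<not> proportional f1 f2"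
        using six[of "U_mat f2" "U_mat f3"] U_mat_proportional[of f1 f2] by fastforce
      show "\<not> proportional f1 f3"
        using six[of "U_mat f2" "U_mat f3"] U_mat_proportional[of f1 f3] by fastforce
      show "\<not> proportional f2 f3"
        using six[of "U_mat f1" "U_mat f3"] U_mat_proportional[of f2 f3] by fastforce
    qed
    obtain k where k: "k \<noteq> 0" and prod: "\<And>x y. sextic_covariant (map_quartic of_int F) x y
        = k * (eval2 f1 x y * eval2 f2 x y * eval2 f3 x y)"
      using three_good_factors(5)[OF F good ne] by blast
    \<comment> \<open>The constant k is absorbed into the first factor.\<close>
    have p: "proportional (map_quadratic ((*) k) f1) f1" "proportional f2 f2" "proportional f3 f3"
      using proportional_scale[OF k] proportional_refl by blast+
    show ?R
      using p good real_good_factor_proportional[OF F good(1) p(1)]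
      by (intro exI[of _ "map_quadratic ((*) k) f1"] exI[of _ f2] exI[of _ f3])
        (simp add: prod eval2_scale mult.assoc)
  next
    assume ?R
    then obtain g1 g2 g3 where gf: "proportional g1 f1" "proportional g2 f2" "proportional g3 f3"
      and g: "real_good_factor F g1" "real_good_factor F g2" "real_good_factor F g3"
      and prod: "\<And>x y. sextic_covariant (map_quartic of_int F) x y
                 = eval2 g1 x y * eval2 g2 x y * eval2 g3 x y" by blast
    have \<Delta>g: "Delta g1 \<noteq> 0" "Delta g2 \<noteq> 0" "Delta g3 \<noteq> 0" using \<Delta> g by blast+
    note distinct = significant_factorization_distinct[OF biquadratic_equiv_of_int[OF F] _ _ _
        sextic_factorization_of_real[OF prod, folded map_quartic_of_int_complex]]
    have "\<not> proportional g1 g2" "\<not> proportional g1 g3" "\<not> proportional g2 g3"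
      using distinct g proportional_of_real \<Delta>g unfolding real_good_factor_def by blast+
    then have ne: "\<not> proportional f1 f2" "\<not> proportional f1 f3" "\<not> proportional f2 f3"
      using gf proportional_sym proportional_trans by blast+
    have good: "real_good_factor F f1" "real_good_factor F f2" "real_good_factor F f3"
      using real_good_factor_proportional[OF F] g gf proportional_sym by blast+
    have f: "Delta f1 \<noteq> 0" "Delta f2 \<noteq> 0" "Delta f3 \<noteq> 0" using \<Delta> good by blast+
    have "U_mat g \<in> ?S \<and> - U_mat g \<in> ?S" if "real_good_factor F g" for g
      using three_good_factors(1)[OF F good ne that] U_mat_proportional[of g f1]
        U_mat_proportional[of g f2] U_mat_proportional[of g f3] by auto
    then have c: "carrier (Aut F) = ?S"
      using carrier_Aut[OF F] good by blast
    \<comment> \<open>Two orthogonal indefinite forms supply the anticommuting involutions, and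
      closure of \<open>Aut F\<close> identifies the third pair of matrices.\<close>
    have iso: "Aut F \<cong> dihedral_group 4"
      if pos: "Delta f > 0" "Delta g > 0" and polar: "polar f g = 0"
        and S: "?S = {mat 1, - mat 1, U_mat f, - U_mat f, U_mat g, - U_mat g, U_mat h, - U_mat h}" for f g h
    proof -
      interpret anticommuting_involutions "U_mat f" "U_mat g"
        using U_mat_square[of f] U_mat_square[of g] pos U_mat_anticommute[OF polar]
        by unfold_locales simp_all
      have "U_mat f \<in> carrier (Aut F)" "U_mat g \<in> carrier (Aut F)" unfolding c S by blast+
      from Aut_mult_closed[OF F this] show ?thesis
        unfolding c S by (subst Aut_eq_carrier_update) (simp only: c S dihedral_iso_closed)
    qed
    have "Aut F \<cong> dihedral_group 4"
    proof -
      note polar = three_good_factors(2-4)[OF F good ne]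
      \<comment> \<open>At most one of three pairwise orthogonal forms is definite.\<close>
      then consider "Delta f1 > 0" "Delta f2 > 0" | "Delta f1 > 0" "Delta f3 > 0"
        | "Delta f2 > 0" "Delta f3 > 0"
        using polar_neq_0_if_definite f by (metis linorder_neqE_linordered_idom)
      then show ?thesis
      proof cases
        case 1
        then show ?thesis by (rule iso) (use polar in auto)
      next
        case 2
        then show ?thesis by (rule iso) (use polar in auto)
      next
        case 3
        then show ?thesis by (rule iso) (use polar in auto)
      qed
    qed
    then show ?L using f c by blast
  qed
qed

end
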